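(* Let $k,r\ge2$ be integers, let $\Gamma$ be the symmetric graph of type $k$ and order $r$ with vertex set $\mathcal V$, and put $Q=(r-1)(k-1)$, $\sigma=k-2$. The dual Abel transform $\mathcal A^*$ is an isomorphism between the space of even functions $g:\mathbb Z\to\mathbb C$ and the space of radial functions $f:\mathcal V\to\mathbb C$. Its inverse $g=(\mathcal A^* )^{-1}f$ is given by $$g(0)=f(0),\qquad g(1)=-\frac{\sigma}{2}\,Q^{-\frac12}f(0)+\frac{r(k-1)}{2}\,Q^{-\frac12}f(1),$$ and $$\begin{aligned}g(n)=&-\frac1{2k}\{Q-1+(r-k)(1-k)^n\}\,Q^{-\frac n2}f(0)\\&-\frac{r(k-1)}{2k}\sum_{0<j<n-1}\{Q-1+(r-k)(1-k)^{n-j}\}\,Q^{j-\frac n2-1}f(j)\\&-\frac12\,r(k-1)\,\sigma\,Q^{\frac n2-2}f(n-1)+\frac12\,r(k-1)\,Q^{\frac n2-1}f(n)\end{aligned}$$ for all $n\ge2$, with the usual convention that sums over empty sets are equal to zero.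
   Context: Symmetric graph: $\Gamma$ is a connected graph in which every vertex $v$ belongs to exactly $r$ polygons with $k$ sides each (for $k=2$ a polygon is a single edge), these polygons having no side and no vertex in common except $v$, and such that every nontrivial loop runs through all the edges of at least one polygon. $\mathcal V$ is its vertex set. The distance $d(x,y)$ is the minimal number of polygons crossed by a path connecting $x$ with $y$. Fix an origin $o\in\mathcal V$ and put $|x|=d(x,o)$. The sphere $\{x:|x|=n\}$ has cardinality $\delta(n)$, with $\delta(0)=1$ and $\delta(n)=r(k-1)Q^{n-1}$ for $n\ge1$. Boundary: $\Omega$ is the set of geodesic rays starting at $o$; a ray $\omega$ is identified with its sequence of nodes $\omega_0=o,\omega_1,\omega_2,\dots$ in $\mathcal V$, with $d(\omega_i,\omega_j)=|i-j|$. The Busemann function is $\zeta(x,\omega)=d(o,\omega_m)-d(x,\omega_m)$ for $m>|x|$ (independent of such $m$), and the horocycles are $H_h(\omega)=\{x\in\mathcal V:\zeta(x,\omega)=h\}$ for $h\in\mathbb Z$. A function on $\mathcal V$ is radial if it depends only on $|x|$; then $f(n)$ is its value at $|x|=n$; $\mathcal D(\mathcal V)^{\sharp}$ is the space of finitely supported radial functions. Abel transform: for $f\in\mathcal D(\mathcal V)^{\sharp}$, $\mathcal Af(h)=Q^{h/2}\sum_{x\in H_h(\omega)}f(x)$, independent of $\omega\in\Omega$ and even in $h\in\mathbb Z$. Dual Abel transform: for an even function $g:\mathbb Z\to\mathbb C$, $\mathcal A^*g$ is the radial function on $\mathcal V$ (identified with a function on $\mathbb N$) defined by $$\sum_{n\in\mathbb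 N}\mathcal A^*g(n)\,f(n)\,\delta(n)=\sum_{h\in\mathbb Z}g(|h|)\,\mathcal Af(|h|)\qquad\text{for all } f\in\mathcal D(\mathcal V)^{\sharp}.$$ *)

theory Defs
  imports "HOL-Analysis.Analysis"
begin

section \<open>Symmetric graphs\<close>

text \<open>
  A graph is given by its edge set, a set of two-element subsets of the vertex type; the vertex
  set is the whole type. Walks and circuits are lists of vertices; the final step of a circuit,
  from the last vertex of the list back to the first one, is implicit.
\<close>

definition walk :: "'v set set \<Rightarrow> 'v \<Rightarrow> 'v list \<Rightarrow> 'v \<Rightarrow> bool" where
  "walk E x p y \<longleftrightarrow> p \<noteq> [] \<and> hd p = x \<and> last p = y \<and> successively (\<lambda>u v. {u, v} \<in> E) p"

definition walk_edges :: "'v list \<Rightarrow> 'v set set" where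
  "walk_edges p = {{p ! i, p ! Suc i} | i. Suc i < length p}"

definition circuit_edges :: "'v list \<Rightarrow> 'v set set" where
  "circuit_edges c = {{c ! i, c ! (Suc i mod length c)} | i. i < length c}"

text \<open>
  A polygon is identified with its set of sides. For \<open>k = 2\<close> the circuit \<open>[u, v]\<close> yields
  the single side \<open>{u, v}\<close>, so that the polygons are exactly the edges of the graph.
\<close>

definition polygons :: "'v set set \<Rightarrow> nat \<Rightarrow> 'v set set set" where
  "polygons E k = {circuit_edges c | c. length c = k \<and> distinct c \<and> circuit_edges c \<subseteq> E}"

text \<open>
  A nontrivial loop is a simple circuit with at least three vertices; every closed walk without
  backtracking contains such a circuit as a segment. For \<open>k = 2\<close> a polygon is a degenerate
  digon, both of whose sides are the same edge; no simple circuit runs through it twice, so the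
  condition on loops says that there are none, and the graph is a homogeneous tree.
  The condition \<open>edge_in_polygon\<close>, that the graph has no edges besides the sides of its
  polygons, is needed for the number of polygons crossed by a path to be meaningful.
\<close>

locale symmetric_graph =
  fixes E :: "'v set set" and k r :: nat
  assumes simple: "e \<in> E \<Longrightarrow> card e = 2"
    and connected: "\<exists>p. walk E x p y"
    and edge_in_polygon: "e \<in> E \<Longrightarrow> \<exists>P\<in>polygons E k. e \<in> P"
    and polygons_at_vertex: "card {P \<in> polygons E k. v \<in> \<Union>P} = r"
    and polygons_meet:
      "\<lbrakk>P \<in> polygons E k; P' \<in> polygons E k; P \<noteq> P'; v \<in> \<Union>P; v \<in> \<Union>P'\<rbrakk>
        \<Longrightarrow> P \<inter> P' = {} \<and> \<Union>P \<inter> \<Union>P' = {v}"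
    and loops:
      "\<lbrakk>length c \<ge> 3; distinct c; circuit_edges c \<subseteq> E\<rbrakk>
        \<Longrightarrow> k \<ge> 3 \<and> (\<exists>P\<in>polygons E k. P \<subseteq> circuit_edges c)"


section \<open>Distance, boundary and horocycles\<close>

definition polygons_crossed :: "'v set set \<Rightarrow> nat \<Rightarrow> 'v list \<Rightarrow> 'v set set set" where
  "polygons_crossed E k p = {P \<in> polygons E k. P \<inter> walk_edges p \<noteq> {}}"

definition gdist :: "'v set set \<Rightarrow> nat \<Rightarrow> 'v \<Rightarrow> 'v \<Rightarrow> nat" where
  "gdist E k x y = (LEAST n. \<exists>p. walk E x p y \<and> n = card (polygons_crossed E k p))"

definition gsphere :: "'v set set \<Rightarrow> nat \<Rightarrow> 'v \<Rightarrow> nat \<Rightarrow> 'v set" where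
  "gsphere E k org n = {x. gdist E k x org = n}"

definition boundary :: "'v set set \<Rightarrow> nat \<Rightarrow> 'v \<Rightarrow> (nat \<Rightarrow> 'v) set" where
  "boundary E k org =
    {\<omega>. \<omega> 0 = org \<and> (\<forall>i j. int (gdist E k (\<omega> i) (\<omega> j)) = \<bar>int i - int j\<bar>)}"

text \<open>
  The Busemann function is \<open>d(org, \<omega> m) - d(x, \<omega> m)\<close> for any \<open>m > d(x, org)\<close>; the value
  does not depend on \<open>m\<close>, and we take the smallest one.
\<close>

definition busemann :: "'v set set \<Rightarrow> nat \<Rightarrow> 'v \<Rightarrow> 'v \<Rightarrow> (nat \<Rightarrow> 'v) \<Rightarrow> int" where
  "busemann E k org x \<omega> =
    (let m = Suc (gdist E k x org)
     in int (gdist E k org (\<omega> m)) - int (gdist E k x (\<omega> m)))"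

definition horocycle :: "'v set set \<Rightarrow> nat \<Rightarrow> 'v \<Rightarrow> int \<Rightarrow> (nat \<Rightarrow> 'v) \<Rightarrow> 'v set" where
  "horocycle E k org h \<omega> = {x. busemann E k org x \<omega> = h}"


section \<open>Radial functions and the Abel transforms\<close>

definition even_functions :: "(int \<Rightarrow> complex) set" where
  "even_functions = {g. \<forall>h. g (- h) = g h}"

definition radial_functions :: "'v set set \<Rightarrow> nat \<Rightarrow> 'v \<Rightarrow> ('v \<Rightarrow> complex) set" where
  "radial_functions E k org =
    {f. \<forall>x y. gdist E k x org = gdist E k y org \<longrightarrow> f x = f y}"

definition test_functions :: "'v set set \<Rightarrow> nat \<Rightarrow> 'v \<Rightarrow> ('v \<Rightarrow> complex) set" where
  "test_functions E k org = {f \<in> radial_functions E k org. finite {x. f x \<noteq> 0}}"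

text \<open>The value \<open>f(n)\<close> of a radial function on the sphere of radius \<open>n\<close>.\<close>

definition radial_value :: "'v set set \<Rightarrow> nat \<Rightarrow> 'v \<Rightarrow> ('v \<Rightarrow> complex) \<Rightarrow> nat \<Rightarrow> complex" where
  "radial_value E k org f n = f (SOME x. x \<in> gsphere E k org n)"

definition branching :: "nat \<Rightarrow> nat \<Rightarrow> real" where
  "branching k r = (real r - 1) * (real k - 1)"

definition abel ::
    "'v set set \<Rightarrow> nat \<Rightarrow> nat \<Rightarrow> 'v \<Rightarrow> (nat \<Rightarrow> 'v) \<Rightarrow> ('v \<Rightarrow> complex) \<Rightarrow> int \<Rightarrow> complex" where
  "abel E k r org \<omega> f h =
    of_real (branching k r powr (of_int h / 2)) * (\<Sum>\<^sub>\<infinity>x\<in>horocycle E k org h \<omega>. f x)"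

text \<open>
  The Abel transform of a radial function does not depend on \<open>\<omega>\<close>, hence the duality is required
  for every \<open>\<omega>\<close>. All the infinite sums have only finitely many nonzero terms.
\<close>

definition is_dual_abel ::
    "'v set set \<Rightarrow> nat \<Rightarrow> nat \<Rightarrow> 'v \<Rightarrow> (int \<Rightarrow> complex) \<Rightarrow> ('v \<Rightarrow> complex) \<Rightarrow> bool" where
  "is_dual_abel E k r org g F \<longleftrightarrow>
    F \<in> radial_functions E k org \<and>
    (\<forall>\<omega>\<in>boundary E k org. \<forall>f\<in>test_functions E k org.
      (\<Sum>\<^sub>\<infinity>n\<in>UNIV. radial_value E k org F n * radial_value E k org f n
                    * of_nat (card (gsphere E k org n))) =
      (\<Sum>\<^sub>\<infinity>h\<in>UNIV. g \<bar>h\<bar> * abel E k r org \<omega> f \<bar>h\<bar>))"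

definition dual_abel ::
    "'v set set \<Rightarrow> nat \<Rightarrow> nat \<Rightarrow> 'v \<Rightarrow> (int \<Rightarrow> complex) \<Rightarrow> ('v \<Rightarrow> complex)" where
  "dual_abel E k r org g = (THE F. is_dual_abel E k r org g F)"

end

(*
  Every polygon P separates its vertices: a walk between two of them that avoids the sides of P
  could be closed up to a simple circuit, which would have to contain another polygon. Hence, seen
  from any vertex a, a polygon has a unique nearest vertex (its gate), all others being one step
  further, and each vertex other than a fails to be the gate of exactly one polygon. Descending the
  spheres around the origin, this determines how the distance to a node of the ray changes, and so
  the number of vertices of a sphere on every horocycle.

  Duality then reads F(n) delta(n) = Q^(n/2) (c(n) + t D(n) + s D(n+1)) with c(0) = g(0),
  c(n) = 2 g(n) for n > 0, s = sigma Q^(-1/2), t = (r-2)(k-1)/Q and D(n) the sum of g(h) over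
  |h| < n, h = n modulo 2. As c(n) = D(n+2) - D(n), this is a linear recurrence for Q^(n/2) D(n)
  with characteristic roots 1 and 1 - k, which is solved explicitly.
*)
theory Submission
  imports Defs
begin


section \<open>Walks and polygons\<close>

text \<open>A polygon can be traversed either way round, so walks realising the distance are far
  from unique and are never compared with each other. What is used instead is being joined by a walk
  in \<open>E - P\<close>. This is an equivalence relation; separation says that each class has at
  most one vertex of \<open>P\<close>, and the gate seen from \<open>a\<close> is the vertex of
  \<open>P\<close> in the class of \<open>a\<close>.

  Spheres are not counted horocycle by horocycle but summed against an arbitrary weight \<phi> of
  the Busemann value, because passing to the next sphere off the ray shifts the argument of \<phi>
  by one. A vertex of the sphere of radius n that parts from the ray at node i has value 2i - n or
  2i + 1 - n; this is where the sums over one parity class come from. Their constants are counts: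
  there are (r-2)(k-1) ways to leave an inner node through a polygon not crossed by the ray, and k -
  2 ways through the crossed one. Since the Abel transform is taken at |h|, negative Busemann values
  drop out.\<close>

lemma walk_edges_simps [simp]:
  "walk_edges [] = {}"
  "walk_edges [x] = {}"
  "walk_edges (x # y # zs) = insert {x, y} (walk_edges (y # zs))"
proof -
  show "walk_edges (x # y # zs) = insert {x, y} (walk_edges (y # zs))"
  proof (intro set_eqI iffI)
    fix e assume "e \<in> walk_edges (x # y # zs)"
    then obtain i where i: "e = {(x # y # zs) ! i, (x # y # zs) ! Suc i}" "Suc i < length (x # y # zs)"
      unfolding walk_edges_def by blast
    show "e \<in> insert {x, y} (walk_edges (y # zs))"
      using i unfolding walk_edges_def by (cases i) auto
  next
    fix e assume "e \<in> insert {x, y} (walk_edges (y # zs))"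
    then consider "e = {x, y}" | i where "e = {(y # zs) ! i, (y # zs) ! Suc i}" "Suc i < length (y # zs)"
      unfolding walk_edges_def by blast
    then show "e \<in> walk_edges (x # y # zs)"
    proof cases
      case 1
      then show ?thesis unfolding walk_edges_def by (auto intro!: exI[of _ 0])
    next
      case 2
      then show ?thesis unfolding walk_edges_def by (auto intro!: exI[of _ "Suc i"])
    qed
  qed
qed (auto simp: walk_edges_def)

lemma walk_edges_append:
  "walk_edges (xs @ v # ys) = walk_edges (xs @ [v]) \<union> walk_edges (v # ys)"
  by (induction xs rule: induct_list012) (auto simp: neq_Nil_conv)

lemma walk_edges_rev: "walk_edges (rev p) = walk_edges p"
proof (induction p rule: induct_list012)
  case (3 x y zs)
  then show ?case
    using walk_edges_append[of "rev zs" y "[x]"] by (auto simp: insert_commute)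
qed simp_all

lemma finite_walk_edges [simp]: "finite (walk_edges p)"
  by (induction p rule: induct_list012) auto

lemma successively_iff_walk_edges:
  "successively (\<lambda>u v. {u, v} \<in> A) p \<longleftrightarrow> walk_edges p \<subseteq> A"
  by (induction p rule: induct_list012) auto

lemma walk_iff: "walk A x p y \<longleftrightarrow> p \<noteq> [] \<and> hd p = x \<and> last p = y \<and> walk_edges p \<subseteq> A"
  by (auto simp: walk_def successively_iff_walk_edges)

lemma Union_walk_edges_subset: "\<Union>(walk_edges p) \<subseteq> set p"
  by (induction p rule: induct_list012) auto

lemma set_subset_Union_walk_edges: "length p \<ge> 2 \<Longrightarrow> set p \<subseteq> \<Union>(walk_edges p)"
proof (induction p rule: induct_list012)
  case (3 x y zs)
  then show ?case by (cases zs) auto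
qed auto

text \<open>The later endpoint of an edge lies in the tail. Hence a walk whose vertices after the
  first avoid a polygon uses none of its sides, which is what \<open>dist_first_step\<close>
  requires.\<close>

lemma walk_edges_Cons_meets: "e \<in> walk_edges (z # b) \<Longrightarrow> e \<inter> set b \<noteq> {}"
  by (induction b arbitrary: z) auto

lemma circuit_edges_eq_walk_edges:
  assumes "c \<noteq> []"
  shows "circuit_edges c = walk_edges (c @ [hd c])"
proof -
  have "(c @ [hd c]) ! Suc i = c ! (Suc i mod length c)" if "i < length c" for i
    using that assms by (cases "Suc i = length c") (auto simp: nth_append hd_conv_nth)
  then show ?thesis
    unfolding circuit_edges_def walk_edges_def
    by (auto simp: nth_append)
qed

lemma Union_circuit_edges: "\<Union>(circuit_edges c) = set c"
proof (cases c)
  case (Cons a b)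
  then show ?thesis
    using Union_walk_edges_subset[of "c @ [hd c]"] set_subset_Union_walk_edges[of "c @ [hd c]"]
    by (auto simp: circuit_edges_eq_walk_edges)
qed (auto simp: circuit_edges_def)

lemma walk_trans:
  assumes "walk A x p y" "walk A' y q z"
  shows "walk (A \<union> A') x (p @ tl q) z" "walk_edges (p @ tl q) = walk_edges p \<union> walk_edges q"
proof -
  obtain p' where p: "p = p' @ [y]"
    using assms(1) by (metis walk_iff append_butlast_last_id)
  obtain q' where q: "q = y # q'"
    using assms(2) by (metis walk_iff list.collapse)
  show eq: "walk_edges (p @ tl q) = walk_edges p \<union> walk_edges q"
    using walk_edges_append[of p' y q'] by (simp add: p q)
  show "walk (A \<union> A') x (p @ tl q) z"
    using assms unfolding walk_iff eq by (auto simp: p q hd_append)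
qed

lemma walk_rev: "walk A x p y \<Longrightarrow> walk A y (rev p) x"
  by (auto simp: walk_iff walk_edges_rev hd_rev last_rev)

section \<open>Reachability and simple paths\<close>

definition reachable :: "'v set set \<Rightarrow> 'v \<Rightarrow> 'v \<Rightarrow> bool" where
  "reachable A x y \<longleftrightarrow> (\<exists>p. walk A x p y)"

lemma reachable_refl [simp]: "reachable A x x"
  unfolding reachable_def by (rule exI[of _ "[x]"]) (simp add: walk_iff)

lemma reachable_edge: "{x, y} \<in> A \<Longrightarrow> reachable A x y"
  unfolding reachable_def by (rule exI[of _ "[x, y]"]) (simp add: walk_iff)

lemma reachable_sym: "reachable A x y \<Longrightarrow> reachable A y x"
  unfolding reachable_def by (metis walk_rev)

lemma reachable_trans: "reachable A x y \<Longrightarrow> reachable A y z \<Longrightarrow> reachable A x z"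
  unfolding reachable_def by (metis walk_trans(1) Un_absorb)

lemma reachable_mono: "reachable A x y \<Longrightarrow> A \<subseteq> B \<Longrightarrow> reachable B x y"
  unfolding reachable_def walk_iff by blast

lemma reachable_circuit:
  assumes "u \<in> set c" "v \<in> set c"
  shows "reachable (circuit_edges c) u v"
proof -
  have *: "reachable (circuit_edges c) (c ! 0) (c ! i)" if "i < length c" for i
    using that
  proof (induction i)
    case (Suc i)
    then have "{c ! i, c ! Suc i} \<in> circuit_edges c"
      unfolding circuit_edges_def by (auto intro!: exI[of _ i])
    then show ?case using Suc reachable_edge reachable_trans by fastforce
  qed simp
  then show ?thesis
    using assms reachable_sym reachable_trans by (metis in_set_conv_nth)
qed

lemma walk_take: "walk A x p y \<Longrightarrow> i < length p \<Longrightarrow> walk A x (take (Suc i) p) (p ! i)"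
  unfolding walk_def by (auto simp: successively_conv_nth hd_conv_nth last_conv_nth min_def intro!: arg_cong[of _ _ "(!) p"])

lemma walk_drop: "walk A x p y \<Longrightarrow> i < length p \<Longrightarrow> walk A (p ! i) (drop i p) y"
  unfolding walk_def by (auto simp: successively_conv_nth hd_drop_conv_nth)

text \<open>If a vertex is repeated, the segment between the two occurrences can be cut out.\<close>

lemma shortest_walk_distinct:
  assumes w: "walk A x p y" and min: "\<And>q. walk A x q y \<Longrightarrow> length p \<le> length q"
  shows "distinct p"
proof (rule ccontr)
  assume "\<not> distinct p"
  then obtain i j where ij: "i < j" "j < length p" "p ! i = p ! j"
    by (metis distinct_conv_nth nat_neq_iff)
  have "walk A x (take (Suc i) p @ tl (drop j p)) y"
    using walk_trans(1)[OF walk_take[OF w, of i] walk_drop[OF w, of j, folded ij(3)]] ij by simp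
  from min[OF this] ij show False by simp
qed

lemma reachable_imp_path:
  assumes "reachable A x y"
  obtains p where "walk A x p y" "distinct p"
proof -
  obtain p where p: "walk A x p y" "\<And>q. walk A x q y \<Longrightarrow> length p \<le> length q"
    using assms ex_has_least_nat[of "\<lambda>p. walk A x p y" _ length] unfolding reachable_def by blast
  show ?thesis using that[OF p(1) shortest_walk_distinct[OF p]] .
qed

text \<open>At the last vertex of the path that lies on the circuit, both neighbours along the
  circuit would have to be the predecessor on the path; with at least three vertices these
  neighbours are distinct.\<close>

lemma circuit_not_in_path:
  assumes "distinct p" "distinct c" "length c \<ge> 3"
  shows "\<not> circuit_edges c \<subseteq> walk_edges p"
proof
  assume sub: "circuit_edges c \<subseteq> walk_edges p"
  have "set c \<subseteq> set p"
    using Union_circuit_edges[of c] Union_walk_edges_subset[of p] Union_mono[OF sub] by simp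
  define T where "T = {t. t < length p \<and> p ! t \<in> set c}"
  have "finite T" unfolding T_def by auto
  have "T \<noteq> {}"
  proof -
    have "c ! 0 \<in> set c" using assms(3) by (intro nth_mem) linarith
    then obtain i where "i < length p" "p ! i = c ! 0"
      using \<open>set c \<subseteq> set p\<close> by (auto simp: in_set_conv_nth subset_iff)
    then have "i \<in> T" using \<open>c ! 0 \<in> set c\<close> by (simp add: T_def)
    then show ?thesis by blast
  qed
  define t where "t = Max T"
  have t: "t \<in> T" "\<And>s. s \<in> T \<Longrightarrow> s \<le> t"
    using \<open>finite T\<close> \<open>T \<noteq> {}\<close> by (auto simp: t_def)
  have prev: "v = p ! (t - 1)" if e: "{p ! t, v} \<in> circuit_edges c" "v \<noteq> p ! t" for v
  proof -
    obtain s where s: "{p ! t, v} = {p ! s, p ! Suc s}" "Suc s < length p"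
      using e(1) sub unfolding walk_edges_def by blast
    have tl: "t < length p" using t(1) by (simp add: T_def)
    have "v \<in> set c" using e(1) Union_circuit_edges[of c] by blast
    consider "p ! t = p ! s" "v = p ! Suc s" | "p ! t = p ! Suc s" "v = p ! s"
      using s(1) e(2) by (metis doubleton_eq_iff)
    then show ?thesis
    proof cases
      case 1
      then have "Suc s \<in> T" "t = s"
        using s(2) tl \<open>v \<in> set c\<close> \<open>distinct p\<close> by (auto simp: T_def nth_eq_iff_index_eq)
      then show ?thesis using t(2) by fastforce
    next
      case 2
      then have "t = Suc s" using s(2) tl \<open>distinct p\<close> by (auto simp: nth_eq_iff_index_eq)
      then show ?thesis using 2 by simp
    qed
  qed
  obtain i where i: "i < length c" "c ! i = p ! t"
    using t(1) unfolding T_def by (auto simp: in_set_conv_nth)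
  define a where "a = (if Suc i = length c then 0 else Suc i)"
  define b where "b = (if i = 0 then length c - 1 else i - 1)"
  have ab: "a < length c" "b < length c" "a \<noteq> b" "a \<noteq> i" "b \<noteq> i"
    using i(1) assms(3) by (auto simp: a_def b_def)
  have "a = Suc i mod length c" "i = Suc b mod length c"
    using i(1) assms(3) by (auto simp: a_def b_def)
  then have "{c ! i, c ! a} \<in> circuit_edges c" "{c ! b, c ! i} \<in> circuit_edges c"
    using i(1) ab(2) unfolding circuit_edges_def by fast+
  then have "{p ! t, c ! a} \<in> circuit_edges c" "{p ! t, c ! b} \<in> circuit_edges c"
    using i(2) by (simp_all add: insert_commute)
  then have "c ! a = c ! b"
    using prev ab i assms(2) by (metis nth_eq_iff_index_eq)
  then show False using ab assms(2) by (simp add: nth_eq_iff_index_eq)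
qed


section \<open>Separation by polygons\<close>

context symmetric_graph
begin

abbreviation "\<P> \<equiv> polygons E k"
abbreviation "d \<equiv> gdist E k"

lemma polygon_cases:
  assumes "P \<in> \<P>"
  obtains c where "length c = k" "distinct c" "P = circuit_edges c" "\<Union>P = set c"
  using assms unfolding polygons_def by (auto simp: Union_circuit_edges)

lemma polygon_subset: "P \<in> \<P> \<Longrightarrow> P \<subseteq> E"
  unfolding polygons_def by auto

lemma card_polygon: "P \<in> \<P> \<Longrightarrow> card (\<Union>P) = k"
  by (metis polygon_cases distinct_card)

lemma reachable_polygon: "P \<in> \<P> \<Longrightarrow> u \<in> \<Union>P \<Longrightarrow> v \<in> \<Union>P \<Longrightarrow> reachable P u v"
  by (metis polygon_cases reachable_circuit)

lemma polygons_disjoint: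
  assumes "P \<in> \<P>" "P' \<in> \<P>" "P \<noteq> P'"
  shows "P \<inter> P' = {}"
proof (rule ccontr)
  assume "P \<inter> P' \<noteq> {}"
  then obtain e where e: "e \<in> P" "e \<in> P'" by blast
  then have "e \<noteq> {}" using simple[of e] polygon_subset[OF assms(1)] by auto
  then obtain v where "v \<in> \<Union>P" "v \<in> \<Union>P'" using e by blast
  then show False using polygons_meet[OF assms] e by blast
qed

lemma polygons_meet_at:
  "\<lbrakk>P \<in> \<P>; P' \<in> \<P>; u \<in> \<Union>P; v \<in> \<Union>P; u \<in> \<Union>P'; v \<in> \<Union>P'; u \<noteq> v\<rbrakk> \<Longrightarrow> P = P'"
  using polygons_meet by blast

lemma reachable_other_polygon:
  assumes "P \<in> \<P>" "P' \<in> \<P>" "P \<noteq> P'" "u \<in> \<Union>P'" "v \<in> \<Union>P'"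
  shows "reachable (E - P) u v"
  using reachable_mono[OF reachable_polygon[OF assms(2,4,5)]] polygons_disjoint[OF assms(1-3)]
    polygon_subset[OF assms(2)] by blast

text \<open>
  A shortest walk outside \<open>P\<close> between two vertices of \<open>P\<close>, closed up by an arc of \<open>P\<close>, would be
  a simple circuit; the polygon contained in it would have to lie on the walk or on the arc.
\<close>

lemma polygon_separates:
  assumes P: "P \<in> \<P>" and "u \<in> \<Union>P" "v \<in> \<Union>P" "reachable (E - P) u v"
  shows "u = v"
proof (rule ccontr)
  assume "u \<noteq> v"
  \<comment> \<open>The walk is minimised over all pairs of distinct endpoints in \<open>P\<close>,
    not only for \<open>u\<close> and \<open>v\<close>; therefore it cannot meet \<open>P\<close> in
    its interior.\<close>
  define W where "W = (\<lambda>(a, p, b). a \<noteq> b \<and> a \<in> \<Union>P \<and> b \<in> \<Union>P \<and> walk (E - P) a p b)"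
  obtain p0 where "walk (E - P) u p0 v" using assms(4) by (auto simp: reachable_def)
  then have "W (u, p0, v)" using \<open>u \<noteq> v\<close> assms(2,3) by (auto simp: W_def)
  then obtain t where t: "W t" "\<And>s. W s \<Longrightarrow> length (fst (snd t)) \<le> length (fst (snd s))"
    using ex_has_least_nat[of W _ "\<lambda>t. length (fst (snd t))"] by blast
  obtain a p b where t_eq: "t = (a, p, b)" by (cases t)
  have ab: "a \<noteq> b" "a \<in> \<Union>P" "b \<in> \<Union>P" and p: "walk (E - P) a p b"
    using t(1) by (auto simp: W_def t_eq)
  have min: "length p \<le> length q" if "a' \<noteq> b'" "a' \<in> \<Union>P" "b' \<in> \<Union>P" "walk (E - P) a' q b'" for a' q b'
    using t(2)[of "(a', q, b')"] that by (auto simp: W_def t_eq)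
  have dp: "distinct p" by (rule shortest_walk_distinct[OF p]) (use min ab in blast)
  have interior: "p ! i \<notin> \<Union>P" if i: "0 < i" "Suc i < length p" for i
  proof
    assume m: "p ! i \<in> \<Union>P"
    have "a = p ! 0" using p by (metis walk_iff hd_conv_nth)
    then have "p ! i \<noteq> a" using nth_eq_iff_index_eq[OF dp, of i 0] i by force
    then have "length p \<le> length (take (Suc i) p)"
      using min[OF _ ab(2) m walk_take[OF p]] i by simp
    then show False using i by simp
  qed
  obtain p' where p': "p = p' @ [b]" using p by (metis walk_iff append_butlast_last_id)
  \<comment> \<open>A single edge outside \<open>P\<close> would lie in a second polygon having both
    endpoints in common with \<open>P\<close>.\<close>
  have len: "length p \<ge> 3"
  proof (rule ccontr)
    assume "\<not> length p \<ge> 3"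
    moreover have "length p \<ge> 2" using p ab(1) unfolding p' by (cases p') (auto simp: walk_iff)
    ultimately have "length p = 2" by simp
    then obtain x y where "p = [x, y]" by (auto simp: length_Suc_conv numeral_2_eq_2)
    then have e: "{a, b} \<in> E - P" using p by (auto simp: walk_iff)
    then obtain P' where P': "P' \<in> \<P>" "{a, b} \<in> P'" using edge_in_polygon by blast
    have "P = P'" using polygons_meet_at[OF P P'(1) ab(2,3) _ _ ab(1)] P'(2) by blast
    then show False using e P' by blast
  qed
  obtain q where q: "walk P b q a" "distinct q"
    using reachable_imp_path[OF reachable_polygon[OF P ab(3,2)]] by blast
  obtain ys where ys: "q = b # ys @ [a]"
    using q(1) ab(1) unfolding walk_iff
    by (metis append_butlast_last_id last_ConsL list.collapse list.distinct(1) last_ConsR)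
  define c where "c = p @ ys"
  have "c \<noteq> []" "hd c = a" using p by (auto simp: c_def walk_iff)
  then have ce: "circuit_edges c = walk_edges p \<union> walk_edges q"
    using walk_edges_append[of p' b "ys @ [a]"] by (simp add: circuit_edges_eq_walk_edges c_def p' ys)
  have pE: "walk_edges p \<subseteq> E - P" and qP: "walk_edges q \<subseteq> P"
    using p q(1) by (auto simp: walk_iff)
  have "set q \<subseteq> \<Union>(walk_edges q)" by (rule set_subset_Union_walk_edges) (simp add: ys)
  also have "\<dots> \<subseteq> \<Union>P" using qP by (rule Union_mono)
  finally have "set ys \<subseteq> \<Union>P - {a, b}" using q(2) by (auto simp: ys)
  moreover have "set p \<inter> \<Union>P \<subseteq> {a, b}"
  proof
    fix x assume x: "x \<in> set p \<inter> \<Union>P"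
    then obtain i where i: "i < length p" "x = p ! i" by (auto simp: in_set_conv_nth)
    then have "i = 0 \<or> i = length p - 1" using interior[of i] x by force
    then show "x \<in> {a, b}" using i p by (auto simp: walk_iff hd_conv_nth last_conv_nth)
  qed
  ultimately have "distinct c" using dp q(2) by (auto simp: c_def ys)
  have "length c \<ge> 3" "circuit_edges c \<subseteq> E"
    using len ce pE qP polygon_subset[OF P] by (auto simp: c_def)
  then obtain P' where k: "k \<ge> 3" and P': "P' \<in> \<P>" "P' \<subseteq> circuit_edges c"
    using loops[OF _ \<open>distinct c\<close>] by blast
  \<comment> \<open>Walk and arc are both simple paths, so neither carries a whole polygon; yet
    \<open>P\<close> could only lie in the arc, and any other polygon only in the walk.\<close>
  have no: "\<not> R \<subseteq> walk_edges w" if "R \<in> \<P>" "distinct w" for R w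
    using circuit_not_in_path[OF that(2)] k by (metis polygon_cases[OF that(1)])
  show False
  proof (cases "P' = P")
    case True
    then show False using no[OF P q(2)] P'(2) ce pE by blast
  next
    case False
    then show False using no[OF P'(1) dp] P'(2) ce qP polygons_disjoint[OF P'(1) P] by blast
  qed
qed

section \<open>The distance\<close>

text \<open>Polygons are disjoint as sets of sides, so each edge accounts for one polygon.
  Finiteness matters because distances are defined by \<open>card\<close>, which is 0 on infinite
  sets.\<close>

lemma finite_polygons_crossed: "walk_edges p \<subseteq> E \<Longrightarrow> finite (polygons_crossed E k p)"
proof -
  assume "walk_edges p \<subseteq> E"
  have "polygons_crossed E k p \<subseteq> (\<lambda>e. THE P. P \<in> \<P> \<and> e \<in> P) ` walk_edges p"
  proof
    fix P assume "P \<in> polygons_crossed E k p"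
    then obtain e where e: "P \<in> \<P>" "e \<in> P" "e \<in> walk_edges p"
      unfolding polygons_crossed_def by blast
    have "(THE P. P \<in> \<P> \<and> e \<in> P) = P"
      using e polygons_disjoint by (intro the_equality) blast+
    then show "P \<in> (\<lambda>e. THE P. P \<in> \<P> \<and> e \<in> P) ` walk_edges p" using e(3) by blast
  qed
  then show ?thesis by (rule finite_subset) simp
qed

lemma dist_le: "walk E x p y \<Longrightarrow> d x y \<le> card (polygons_crossed E k p)"
  unfolding gdist_def by (rule Least_le) blast

lemma dist_walk:
  obtains p where "walk E x p y" "card (polygons_crossed E k p) = d x y"
proof -
  have "\<exists>p. walk E x p y \<and> d x y = card (polygons_crossed E k p)"
    unfolding gdist_def 
    using connected[of x y] LeastI_ex[of "\<lambda>n. \<exists>p. walk E x p y \<and> n = card (polygons_crossed E k p)"]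
    by blast
  then show ?thesis using that by metis
qed

lemma dist_self [simp]: "d x x = 0"
  using dist_le[of x "[x]" x] by (simp add: walk_iff polygons_crossed_def)

lemma dist_triangle: "d x z \<le> d x y + d y z"
proof -
  obtain p where p: "walk E x p y" "card (polygons_crossed E k p) = d x y" by (rule dist_walk)
  obtain q where q: "walk E y q z" "card (polygons_crossed E k q) = d y z" by (rule dist_walk)
  have "polygons_crossed E k (p @ tl q) = polygons_crossed E k p \<union> polygons_crossed E k q"
    using walk_trans(2)[OF p(1) q(1)] by (auto simp: polygons_crossed_def)
  then have "d x z \<le> card (polygons_crossed E k p \<union> polygons_crossed E k q)"
    using dist_le[of x "p @ tl q" z] walk_trans(1)[OF p(1) q(1)] by simp
  also have "\<dots> \<le> d x y + d y z"
    using card_Un_le p(2) q(2) by metis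
  finally show ?thesis .
qed

lemma dist_commute: "d x y = d y x"
proof -
  have "d y x \<le> d x y" for x y
  proof -
    obtain p where p: "walk E x p y" "card (polygons_crossed E k p) = d x y" by (rule dist_walk)
    show ?thesis
      using dist_le[OF walk_rev[OF p(1)]] p(2) by (simp add: polygons_crossed_def walk_edges_rev)
  qed
  then show ?thesis by (simp add: antisym)
qed

lemma dist_polygon:
  assumes "P \<in> \<P>" "x \<in> \<Union>P" "y \<in> \<Union>P"
  shows "d x y \<le> 1"
proof -
  obtain p where p: "walk P x p y" using reachable_polygon[OF assms] by (auto simp: reachable_def)
  then have "walk E x p y" using polygon_subset[OF assms(1)] by (auto simp: walk_iff)
  have "polygons_crossed E k p \<subseteq> {P}"
    using p polygons_disjoint[OF assms(1)] by (fastforce simp: polygons_crossed_def walk_iff)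
  then have "card (polygons_crossed E k p) \<le> card {P}" by (intro card_mono) auto
  then show ?thesis using dist_le[OF \<open>walk E x p y\<close>] by simp
qed

text \<open>
  An optimal walk is cut at its last vertex in the first polygon that it crosses: this polygon
  is not crossed any more.
\<close>

lemma dist_first_step:
  assumes "x \<noteq> y"
  obtains z P where "P \<in> \<P>" "x \<in> \<Union>P" "z \<in> \<Union>P" "Suc (d z y) = d x y"
proof -
  obtain p where p: "walk E x p y" "card (polygons_crossed E k p) = d x y" by (rule dist_walk)
  obtain w p' where xw: "p = x # w # p'"
    using p(1) assms unfolding walk_iff by (metis last_ConsL list.collapse)
  then have "{x, w} \<in> E" using p(1) by (simp add: walk_iff)
  then obtain P where P: "P \<in> \<P>" "{x, w} \<in> P" using edge_in_polygon by blast
  then have crossed: "P \<in> polygons_crossed E k p" by (auto simp: polygons_crossed_def xw)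
  have "\<exists>z\<in>set p. z \<in> \<Union>P" using P(2) by (auto simp: xw)
  then obtain a z b where s: "p = a @ z # b" "z \<in> \<Union>P" "\<forall>y\<in>set b. y \<notin> \<Union>P"
    using split_list_last_prop[of p "\<lambda>z. z \<in> \<Union>P"] by blast
  have sub: "walk_edges (z # b) \<subseteq> walk_edges p" using walk_edges_append[of a z b] by (simp add: s)
  then have zb: "walk E z (z # b) y" using p(1) by (auto simp: walk_iff s(1))
  have "P \<inter> walk_edges (z # b) = {}" using walk_edges_Cons_meets[of _ z b] s(3) by blast
  then have "polygons_crossed E k (z # b) \<subseteq> polygons_crossed E k p - {P}"
    using sub by (auto simp: polygons_crossed_def)
  moreover have fin: "finite (polygons_crossed E k p)"
    using p(1) by (intro finite_polygons_crossed) (simp add: walk_iff)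
  ultimately have "d z y \<le> card (polygons_crossed E k p - {P})"
    using dist_le[OF zb] card_mono[of "polygons_crossed E k p - {P}" "polygons_crossed E k (z # b)"]
    by (meson finite_Diff le_trans)
  moreover have "card (polygons_crossed E k p) = Suc (card (polygons_crossed E k p - {P}))"
    using fin crossed by (rule card.remove)
  ultimately have "Suc (d z y) \<le> d x y" using p(2) by simp
  moreover have "x \<in> \<Union>P" using P(2) by blast
  then have "d x y \<le> Suc (d z y)" using dist_triangle[of x y z] dist_polygon[OF P(1) _ s(2)] by force
  ultimately show ?thesis using that[OF P(1) \<open>x \<in> \<Union>P\<close> s(2)] by simp
qed

lemma dist_eq_0_iff [simp]: "d x y = 0 \<longleftrightarrow> x = y"
  by (metis dist_self dist_first_step nat.distinct(1))

section \<open>Gates of polygons\<close>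

definition is_gate :: "'v \<Rightarrow> 'v set set \<Rightarrow> 'v \<Rightarrow> bool" where
  "is_gate a P p \<longleftrightarrow> p \<in> \<Union>P \<and> (\<forall>q\<in>\<Union>P. q \<noteq> p \<longrightarrow> d a q = Suc (d a p))"

text \<open>Each step towards \<open>a\<close> leads strictly nearer than all of \<open>P\<close>,
  hence off \<open>P\<close>, and so runs through another polygon. The vertex \<open>p\<close> may
  lie off \<open>P\<close>; \<open>not_gate_unique\<close> applies this to the gate of a different
  polygon.\<close>

lemma nearest_reachable:
  assumes P: "P \<in> \<P>" and "\<And>q. q \<in> \<Union>P \<Longrightarrow> d p a \<le> d q a"
  shows "reachable (E - P) p a"
  using assms(2)
proof (induction "d p a" arbitrary: p)
  case 0
  then show ?case by simp
next
  case (Suc n)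
  then have "p \<noteq> a" by auto
  then obtain z P' where z: "P' \<in> \<P>" "p \<in> \<Union>P'" "z \<in> \<Union>P'" "Suc (d z a) = d p a"
    by (rule dist_first_step)
  have "z \<notin> \<Union>P" using Suc.prems[of z] z(4) by auto
  then have "reachable (E - P) p z" using reachable_other_polygon[OF P z(1) _ z(2,3)] z(3) by blast
  moreover have "reachable (E - P) z a"
    using Suc z(4) by (metis Suc_le_D Suc_inject le_trans lessI less_imp_le)
  ultimately show ?case by (rule reachable_trans)
qed

text \<open>Two nearest vertices would both be joined to \<open>a\<close>, and so to each other,
  outside \<open>P\<close>, against \<open>polygon_separates\<close>. Since distances within a
  polygon are at most 1, every other vertex is exactly one step farther.\<close>

lemma gate_exists:
  assumes P: "P \<in> \<P>" and "\<Union>P \<noteq> {}"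
  obtains p where "is_gate a P p"
proof -
  obtain p where p: "p \<in> \<Union>P" "\<And>q. q \<in> \<Union>P \<Longrightarrow> d p a \<le> d q a"
    using ex_has_least_nat[of "\<lambda>p. p \<in> \<Union>P" _ "\<lambda>p. d p a"] assms(2) by blast
  have "d a q = Suc (d a p)" if q: "q \<in> \<Union>P" "q \<noteq> p" for q
  proof (rule ccontr)
    assume "d a q \<noteq> Suc (d a p)"
    moreover have "d a q \<le> Suc (d a p)"
      using dist_triangle[of a q p] dist_polygon[OF P p(1) q(1)] by simp
    ultimately have "d q a \<le> d p a" by (simp add: dist_commute)
    then have "reachable (E - P) q a" "reachable (E - P) p a"
      using p(2) by (auto intro!: nearest_reachable[OF P] intro: le_trans)
    then have "reachable (E - P) q p" using reachable_sym reachable_trans by metis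
    then show False using polygon_separates[OF P q(1) p(1)] q(2) by blast
  qed
  then show ?thesis using that p(1) by (auto simp: is_gate_def)
qed

lemma gate_nearest: "is_gate a P p \<Longrightarrow> q \<in> \<Union>P \<Longrightarrow> d a p \<le> d a q"
  by (cases "q = p") (auto simp: is_gate_def)

lemma gate_unique: "is_gate a P p \<Longrightarrow> is_gate a P q \<Longrightarrow> p = q"
  unfolding is_gate_def by (metis lessI not_less_iff_gr_or_eq)

text \<open>The gates \<open>g\<close> and \<open>g'\<close> of the two polygons are equally far
  from \<open>a\<close>, so both are joined to \<open>a\<close> outside \<open>P'\<close>. Going
  from \<open>y\<close> to \<open>g\<close> along \<open>P\<close> then joins \<open>y\<close> to
  \<open>g'\<close> outside \<open>P'\<close>, although both lie on \<open>P'\<close>.\<close>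

lemma not_gate_unique:
  assumes P: "P \<in> \<P>" "P' \<in> \<P>" and y: "y \<in> \<Union>P" "y \<in> \<Union>P'" "\<not> is_gate a P y" "\<not> is_gate a P' y"
  shows "P = P'"
proof (rule ccontr)
  assume ne: "P \<noteq> P'"
  obtain g g' where g: "is_gate a P g" "is_gate a P' g'" using gate_exists P y by (metis empty_iff)
  then have ne': "g \<noteq> y" "g' \<noteq> y" using y by auto
  then have "d a y = Suc (d a g)" "d a y = Suc (d a g')" using g y by (auto simp: is_gate_def)
  then have "d g a = d g' a" by (simp add: dist_commute)
  moreover have "d g' a \<le> d q a" if "q \<in> \<Union>P'" for q
    using gate_nearest[OF g(2) that] by (simp add: dist_commute)
  ultimately have "reachable (E - P') g a" "reachable (E - P') g' a"
    using nearest_reachable[OF P(2)] by simp_all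
  moreover have gP: "g \<in> \<Union>P" "g' \<in> \<Union>P'" using g by (auto simp: is_gate_def)
  then have "reachable (E - P') y g" using reachable_other_polygon[OF P(2,1) ne[symmetric] y(1)] by blast
  ultimately have "reachable (E - P') y g'" using reachable_sym reachable_trans by metis
  then show False using polygon_separates[OF P(2) y(2) gP(2)] ne' by blast
qed

text \<open>The polygon through which an optimal walk from \<open>y\<close> to \<open>a\<close>
  starts contains a vertex nearer to \<open>a\<close>.\<close>

lemma not_gate_exists:
  assumes "y \<noteq> a"
  obtains P where "P \<in> \<P>" "y \<in> \<Union>P" "\<not> is_gate a P y"
proof -
  obtain z P where z: "P \<in> \<P>" "y \<in> \<Union>P" "z \<in> \<Union>P" "Suc (d z a) = d y a"
    using dist_first_step[OF assms] .
  then have "\<not> is_gate a P y" 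
    using gate_nearest[of a P y z] dist_commute[of z a] dist_commute[of y a] by auto
  then show ?thesis using that z by blast
qed

text \<open>On a polygon the distance from \<open>a\<close> takes only two values, the smaller one
  at the gate alone.\<close>

lemma gate_iff_nearer:
  assumes "P \<in> \<P>" "x \<in> \<Union>P" "y \<in> \<Union>P" "d a y = Suc (d a x)"
  shows "is_gate a P x"
proof -
  obtain p where p: "is_gate a P p" using gate_exists assms(1,2) by (metis empty_iff)
  have "y \<noteq> p" using gate_nearest[OF p assms(2)] assms(4) by auto
  then have "x = p" using p assms unfolding is_gate_def by (metis Suc_inject n_not_Suc_n)
  then show ?thesis using p by simp
qed

end


section \<open>Spheres and rays\<close>

locale rooted_symmetric_graph = symmetric_graph E k r
  for E :: "'v set set" and k r :: nat +
  fixes org :: 'v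
  assumes k_ge: "k \<ge> 2" and r_ge: "r \<ge> 2"
begin

abbreviation "S \<equiv> gsphere E k org"

section \<open>Growth of the spheres\<close>

definition child_polygons :: "'v \<Rightarrow> 'v set set set" where
  "child_polygons x = {P \<in> \<P>. x \<in> \<Union>P \<and> is_gate org P x}"

lemma mem_sphere_iff: "x \<in> S n \<longleftrightarrow> d org x = n"
  by (simp add: gsphere_def dist_commute)

lemma sphere_0: "S 0 = {org}"
  by (auto simp: mem_sphere_iff)

text \<open>An infinite set would have \<open>card\<close> 0, whereas this one has
  \<open>card\<close> r.\<close>

lemma finite_polygons_at: "finite {P \<in> \<P>. x \<in> \<Union>P}"
  using polygons_at_vertex[of x] r_ge by (intro card_ge_0_finite) linarith

lemma finite_child_polygons [simp]: "finite (child_polygons x)"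
  using finite_polygons_at[of x] by (rule rev_finite_subset) (auto simp: child_polygons_def)

lemma finite_polygon_vertices: "P \<in> \<P> \<Longrightarrow> finite (\<Union>P)"
  using card_polygon[of P] k_ge by (intro card_ge_0_finite) linarith

lemma gate_self: "P \<in> \<P> \<Longrightarrow> a \<in> \<Union>P \<Longrightarrow> is_gate a P a"
  by (metis dist_eq_0_iff empty_iff gate_exists gate_nearest le_zero_eq)

lemma card_child_polygons: "card (child_polygons x) = (if x = org then r else r - 1)"
proof (cases "x = org")
  case True
  then have "child_polygons x = {P \<in> \<P>. x \<in> \<Union>P}"
    using gate_self by (auto simp: child_polygons_def)
  then show ?thesis using polygons_at_vertex[of x] True by simp
next
  case False
  obtain P where P: "P \<in> \<P>" "x \<in> \<Union>P" "\<not> is_gate org P x" using not_gate_exists[OF False] .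
  then have "child_polygons x = {P \<in> \<P>. x \<in> \<Union>P} - {P}"
    using not_gate_unique[OF _ P(1) _ P(2) _ P(3)] unfolding child_polygons_def by blast
  then show ?thesis using polygons_at_vertex[of x] P(1,2) False finite_polygons_at[of x] by simp
qed

lemma child_not_gate: "P \<in> child_polygons x \<Longrightarrow> y \<in> \<Union>P - {x} \<Longrightarrow> \<not> is_gate org P y"
  using gate_unique by (auto simp: child_polygons_def)

text \<open>\<open>P\<close> is the only polygon of which \<open>y\<close> is not the gate, and
  \<open>x\<close> is its gate. Thus the children of a sphere form a disjoint union, and sums over
  the next sphere become iterated sums.\<close>

lemma child_unique:
  assumes "P \<in> child_polygons x" "P' \<in> child_polygons x'" "y \<in> \<Union>P - {x}" "y \<in> \<Union>P' - {x'}"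
  shows "P = P'" "x = x'"
proof -
  show "P = P'"
    using not_gate_unique[of P P' y org] child_not_gate[OF assms(1,3)] child_not_gate[OF assms(2,4)] assms
    by (auto simp: child_polygons_def)
  then show "x = x'" using assms gate_unique by (auto simp: child_polygons_def)
qed

lemma sphere_Suc: "S (Suc n) = (\<Union>x\<in>S n. \<Union>P\<in>child_polygons x. \<Union>P - {x})"
proof (intro set_eqI iffI)
  fix y assume y: "y \<in> S (Suc n)"
  then have "y \<noteq> org" by (auto simp: mem_sphere_iff)
  then obtain P where P: "P \<in> \<P>" "y \<in> \<Union>P" "\<not> is_gate org P y" by (rule not_gate_exists)
  then obtain x where x: "is_gate org P x" using gate_exists[of P org] by blast
  then have "x \<noteq> y" using P by auto
  then have "x \<in> S n" using x y P by (auto simp: is_gate_def mem_sphere_iff)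
  moreover have "P \<in> child_polygons x" using x P by (auto simp: child_polygons_def is_gate_def)
  ultimately show "y \<in> (\<Union>x\<in>S n. \<Union>P\<in>child_polygons x. \<Union>P - {x})" using P \<open>x \<noteq> y\<close> by blast
next
  fix y assume "y \<in> (\<Union>x\<in>S n. \<Union>P\<in>child_polygons x. \<Union>P - {x})"
  then show "y \<in> S (Suc n)" by (auto simp: child_polygons_def is_gate_def mem_sphere_iff)
qed

lemma finite_children: "P \<in> child_polygons x \<Longrightarrow> finite (\<Union>P - {x})"
  using finite_polygon_vertices by (auto simp: child_polygons_def)

lemma card_children: "P \<in> child_polygons x \<Longrightarrow> card (\<Union>P - {x}) = k - 1"
  using finite_polygon_vertices card_polygon by (auto simp: child_polygons_def)

lemma finite_sphere [simp]: "finite (S n)"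
proof (induction n)
  case 0
  then show ?case by (simp add: sphere_0)
next
  case (Suc n)
  then show ?case unfolding sphere_Suc by (intro finite_UN_I finite_children finite_child_polygons)
qed

lemma sum_sphere_Suc:
  "sum f (S (Suc n)) = (\<Sum>x\<in>S n. \<Sum>P\<in>child_polygons x. \<Sum>y\<in>\<Union>P - {x}. f y)"
proof -
  have "sum f (S (Suc n)) = (\<Sum>x\<in>S n. sum f (\<Union>P\<in>child_polygons x. \<Union>P - {x}))"
    unfolding sphere_Suc
  proof (rule sum.UNION_disjoint)
    show "\<forall>x\<in>S n. finite (\<Union>P\<in>child_polygons x. \<Union>P - {x})"
      by (intro ballI finite_UN_I finite_children finite_child_polygons)
    show "\<forall>x\<in>S n. \<forall>x'\<in>S n. x \<noteq> x' \<longrightarrow>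
      (\<Union>P\<in>child_polygons x. \<Union>P - {x}) \<inter> (\<Union>P\<in>child_polygons x'. \<Union>P - {x'}) = {}"
      using child_unique(2) by blast
  qed simp
  also have "\<dots> = (\<Sum>x\<in>S n. \<Sum>P\<in>child_polygons x. \<Sum>y\<in>\<Union>P - {x}. f y)"
  proof (rule sum.cong[OF refl], rule sum.UNION_disjoint)
    fix x
    show "\<forall>P\<in>child_polygons x. finite (\<Union>P - {x})" by (intro ballI finite_children)
    show "\<forall>P\<in>child_polygons x. \<forall>P'\<in>child_polygons x. P \<noteq> P' \<longrightarrow> (\<Union>P - {x}) \<inter> (\<Union>P' - {x}) = {}"
      using child_unique(1) by blast
  qed simp
  finally show ?thesis .
qed

lemma card_sphere_Suc: "card (S (Suc n)) = r * (k - 1) * ((r - 1) * (k - 1)) ^ n"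
proof (induction n)
  case 0
  have "card (S (Suc 0)) = (\<Sum>P\<in>child_polygons org. \<Sum>y\<in>\<Union>P - {org}. 1)"
    unfolding card_eq_sum sum_sphere_Suc by (simp add: sphere_0)
  also have "\<dots> = (\<Sum>P\<in>child_polygons org. k - 1)"
    by (intro sum.cong refl) (simp add: card_children)
  finally show ?case by (simp add: card_child_polygons)
next
  case (Suc n)
  have "card (S (Suc (Suc n))) = (\<Sum>x\<in>S (Suc n). \<Sum>P\<in>child_polygons x. \<Sum>y\<in>\<Union>P - {x}. 1)"
    unfolding card_eq_sum sum_sphere_Suc[of _ "Suc n"] ..
  also have "\<dots> = (\<Sum>x\<in>S (Suc n). \<Sum>P\<in>child_polygons x. k - 1)"
    by (intro sum.cong refl) (simp add: card_children)
  also have "\<dots> = (\<Sum>x\<in>S (Suc n). (r - 1) * (k - 1))"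
    by (intro sum.cong refl) (auto simp: card_child_polygons mem_sphere_iff)
  finally show ?case using Suc by (simp only: sum_constant power_Suc of_nat_id mult_ac)
qed

lemma card_sphere_pos: "card (S n) > 0"
  using k_ge r_ge by (cases n) (auto simp: sphere_0 card_sphere_Suc)

lemma sphere_nonempty: "S n \<noteq> {}"
  using card_sphere_pos[of n] by auto

text \<open>Duality is required for every ray, so without a ray it would be vacuous and could not
  determine the dual transform. A ray arises by choosing a child again and again.\<close>

lemma boundary_nonempty: "boundary E k org \<noteq> {}"
proof -
  define next_vertex where "next_vertex x = (SOME y. \<exists>P\<in>child_polygons x. y \<in> \<Union>P - {x})" for x
  have ex: "\<exists>y. \<exists>P\<in>child_polygons x. y \<in> \<Union>P - {x}" for x
  proof -
    have "card (child_polygons x) > 0" using r_ge by (simp add: card_child_polygons)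
    then obtain P where P: "P \<in> child_polygons x" by (metis card.empty equals0I less_irrefl)
    then have "card (\<Union>P - {x}) > 0" using k_ge by (simp add: card_children)
    then show ?thesis using P by (metis card.empty equals0I less_irrefl)
  qed
  define w where "w = rec_nat org (\<lambda>_. next_vertex)"
  have step: "\<exists>P\<in>child_polygons (w n). w (Suc n) \<in> \<Union>P - {w n}" for n
    using someI_ex[OF ex[of "w n"]] by (simp add: w_def next_vertex_def)
  have level: "d org (w n) = n" for n
  proof (induction n)
    case (Suc n)
    then show ?case using step[of n] by (auto simp: child_polygons_def is_gate_def)
  qed (simp add: w_def)
  have near: "d (w n) (w (Suc n)) \<le> 1" for n
    using step[of n] dist_polygon by (auto simp: child_polygons_def)
  have upper: "d (w i) (w (i + l)) \<le> l" for i l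
  proof (induction l)
    case (Suc l)
    then show ?case using dist_triangle[of "w i" "w (i + Suc l)" "w (i + l)"] near[of "i + l"] by simp
  qed simp
  \<comment> \<open>The levels of the two vertices differ by \<open>l\<close>, which bounds the
    distance from below.\<close>
  have "d (w i) (w (i + l)) = l" for i l
    using upper[of i l] dist_triangle[of org "w (i + l)" "w i"] by (simp add: level)
  then have "i \<le> j \<Longrightarrow> d (w i) (w j) = j - i" for i j
    by (metis le_add_diff_inverse)
  then have "int (d (w i) (w j)) = \<bar>int i - int j\<bar>" for i j
    using dist_commute[of "w i" "w j"] by (cases "i \<le> j") auto
  then have "w \<in> boundary E k org" by (auto simp: boundary_def w_def)
  then show ?thesis by blast
qed

section \<open>Rays and the distribution of a sphere over the horocycles\<close>

context
  fixes \<omega> assumes \<omega>: "\<omega> \<in> boundary E k org"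
begin

lemma ray_0: "\<omega> 0 = org"
  using \<omega> by (simp add: boundary_def)

lemma ray_dist: "i \<le> j \<Longrightarrow> d (\<omega> i) (\<omega> j) = j - i"
proof -
  assume "i \<le> j"
  moreover have "int (d (\<omega> i) (\<omega> j)) = \<bar>int i - int j\<bar>" using \<omega> by (simp add: boundary_def)
  ultimately show ?thesis by linarith
qed

lemma ray_level: "d org (\<omega> n) = n"
  using ray_dist[of 0 n] by (simp add: ray_0)

text \<open>Nodes at distance 1 share a polygon. Seen from the origin its gate is the earlier node,
  seen from \<omega> m the later one.\<close>

lemma ray_polygon:
  assumes "n < m"
  obtains P where "P \<in> child_polygons (\<omega> n)" "\<omega> (Suc n) \<in> \<Union>P - {\<omega> n}" "is_gate (\<omega> m) P (\<omega> (Suc n))"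
proof -
  have 1: "d (\<omega> n) (\<omega> (Suc n)) = 1" by (simp add: ray_dist)
  then have ne: "\<omega> n \<noteq> \<omega> (Suc n)" by auto
  then obtain z P where P: "P \<in> \<P>" "\<omega> n \<in> \<Union>P" "z \<in> \<Union>P" "Suc (d z (\<omega> (Suc n))) = d (\<omega> n) (\<omega> (Suc n))"
    by (rule dist_first_step)
  then have P': "\<omega> (Suc n) \<in> \<Union>P" using 1 by simp
  have "is_gate org P (\<omega> n)" by (rule gate_iff_nearer[OF P(1,2) P']) (simp add: ray_level)
  moreover have "d (\<omega> m) (\<omega> n) = Suc (d (\<omega> m) (\<omega> (Suc n)))"
    using assms by (simp add: dist_commute[of "\<omega> m"] ray_dist)
  then have "is_gate (\<omega> m) P (\<omega> (Suc n))" by (rule gate_iff_nearer[OF P(1) P' P(2)])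
  ultimately show ?thesis using that[of P] P P' ne by (auto simp: child_polygons_def)
qed

text \<open>The polygon shared with the next node is already the one of which \<omega> n is not the
  gate, seen from \<omega> m.\<close>

lemma ray_off_polygon_gate:
  assumes "n < m" "P \<in> \<P>" "\<omega> n \<in> \<Union>P" "\<omega> (Suc n) \<notin> \<Union>P"
  shows "is_gate (\<omega> m) P (\<omega> n)"
proof (rule ccontr)
  assume *: "\<not> is_gate (\<omega> m) P (\<omega> n)"
  obtain P' where P': "P' \<in> child_polygons (\<omega> n)" "\<omega> (Suc n) \<in> \<Union>P' - {\<omega> n}"
      "is_gate (\<omega> m) P' (\<omega> (Suc n))"
    using ray_polygon[OF assms(1)] .
  then have "\<not> is_gate (\<omega> m) P' (\<omega> n)" using gate_unique by blast
  then have "P = P'"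
    using not_gate_unique[OF assms(2) _ assms(3) _ *] P'(1) by (auto simp: child_polygons_def)
  then show False using assms(4) P' by blast
qed

text \<open>
  Off the ray, the polygon leading back to the origin is also the one leading to \<open>\<omega> m\<close>.
\<close>

lemma off_ray_gate:
  assumes "n \<le> m" "y \<in> S n" "y \<noteq> \<omega> n" "P \<in> child_polygons y"
  shows "is_gate (\<omega> m) P y"
  using assms
proof (induction n arbitrary: y P)
  case 0
  then show ?case by (simp add: sphere_0 ray_0)
next
  case (Suc n)
  obtain x P0 where x: "x \<in> S n" "P0 \<in> child_polygons x" "y \<in> \<Union>P0 - {x}"
    using Suc.prems(2) unfolding sphere_Suc by blast
  \<comment> \<open>Seen from \<omega> m, the gate of \<open>P0\<close> is the next node if
    \<open>P0\<close> is crossed by the ray, and the parent \<open>x\<close> otherwise. So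
    \<open>P0\<close> uses up the one polygon of which \<open>y\<close> may fail to be the
    gate.\<close>
  have "\<not> is_gate (\<omega> m) P0 y"
  proof (cases "x = \<omega> n \<and> \<omega> (Suc n) \<in> \<Union>P0")
    case True
    have "n < m" using Suc.prems(1) by simp
    then obtain P1 where P1: "P1 \<in> child_polygons (\<omega> n)" "\<omega> (Suc n) \<in> \<Union>P1 - {\<omega> n}"
        "is_gate (\<omega> m) P1 (\<omega> (Suc n))"
      by (rule ray_polygon)
    then have "P0 = P1" using child_unique(1)[OF x(2) P1(1), of "\<omega> (Suc n)"] True by blast
    then show ?thesis using P1(3) Suc.prems(3) gate_unique by blast
  next
    case False
    have "is_gate (\<omega> m) P0 x"
    proof (cases "x = \<omega> n")
      case True
      then show ?thesis
        using False ray_off_polygon_gate[of n m P0] x(2) Suc.prems(1) by (auto simp: child_polygons_def)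
    next
      case False
      then show ?thesis using Suc x by simp
    qed
    then show ?thesis using x(3) gate_unique by blast
  qed
  moreover have "P \<noteq> P0" using Suc.prems(4) child_not_gate[OF x(2,3)] by (auto simp: child_polygons_def)
  ultimately show ?case
    using not_gate_unique[of P P0 y "\<omega> m"] Suc.prems(4) x by (auto simp: child_polygons_def)
qed

lemma sum_children_gate:
  fixes \<phi> :: "int \<Rightarrow> complex"
  assumes "P \<in> child_polygons x" "is_gate z P x"
  shows "(\<Sum>y\<in>\<Union>P - {x}. \<phi> (m - int (d y z))) = of_nat (k - 1) * \<phi> (m - int (d x z) - 1)"
proof -
  have "d y z = Suc (d x z)" if "y \<in> \<Union>P - {x}" for y
    using that assms(2) unfolding dist_commute[of _ z] is_gate_def by blast
  then have "(\<Sum>y\<in>\<Union>P - {x}. \<phi> (m - int (d y z))) = (\<Sum>y\<in>\<Union>P - {x}. \<phi> (m - int (d x z) - 1))"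
    by (intro sum.cong refl) (simp add: algebra_simps)
  then show ?thesis using card_children[OF assms(1)] by simp
qed

text \<open>
  In the sum below, \<open>i\<close> is the index of the last node common to \<open>\<omega>\<close> and to the geodesic from the
  origin; the geodesic leaves this node either through a polygon not crossed by \<open>\<omega>\<close>, or through
  the same polygon as \<open>\<omega>\<close>.
\<close>

lemma sum_sphere_off_ray:
  fixes \<phi> :: "int \<Rightarrow> complex"
  assumes "n \<le> m"
  shows "(\<Sum>x\<in>S n - {\<omega> n}. \<phi> (int m - int (d x (\<omega> m)))) =
    (\<Sum>i<n. of_nat ((r - 1) * (k - 1)) ^ (n - 1 - i) *
      (of_nat (if i = 0 then r - 1 else r - 2) * of_nat (k - 1) * \<phi> (2 * int i - int n)
       + of_nat (k - 2) * \<phi> (2 * int i + 1 - int n)))"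
  using assms
proof (induction n arbitrary: \<phi>)
  case 0
  then show ?case by (simp add: sphere_0 ray_0)
next
  case (Suc n)
  define c where "c x = (\<Sum>P\<in>child_polygons x. \<Sum>y\<in>\<Union>P - {x}. \<phi> (int m - int (d y (\<omega> m))))" for x
  define b :: complex where "b = of_nat ((r - 1) * (k - 1))"
  define a :: "nat \<Rightarrow> complex" where "a i = of_nat (if i = 0 then r - 1 else r - 2)" for i
  have on_sphere: "\<omega> j \<in> S j" for j by (simp add: mem_sphere_iff ray_level)
  \<comment> \<open>Off the ray all \<open>(r - 1) * (k - 1)\<close> children lie one horocycle
    lower, so the induction hypothesis will be applied to the shifted weight.\<close>
  have "c x = b * \<phi> (int m - int (d x (\<omega> m)) - 1)" if x: "x \<in> S n - {\<omega> n}" for x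
  proof -
    have "c x = (\<Sum>P\<in>child_polygons x. of_nat (k - 1) * \<phi> (int m - int (d x (\<omega> m)) - 1))"
      unfolding c_def
      by (intro sum.cong refl sum_children_gate off_ray_gate[of n m]) (use x Suc.prems in auto)
    moreover have "x \<noteq> org" using x sphere_0 ray_0 by (auto simp: mem_sphere_iff)
    ultimately show ?thesis by (simp add: card_child_polygons b_def)
  qed
  then have "(\<Sum>x\<in>S n - {\<omega> n}. c x) = b * (\<Sum>x\<in>S n - {\<omega> n}. \<phi> (int m - int (d x (\<omega> m)) - 1))"
    by (simp add: sum_distrib_left)
  also have "\<dots> = b * (\<Sum>i<n. b ^ (n - 1 - i) * (a i * of_nat (k - 1) * \<phi> (2 * int i - int n - 1)
       + of_nat (k - 2) * \<phi> (2 * int i + 1 - int n - 1)))"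
    using Suc.IH[of "\<lambda>h. \<phi> (h - 1)"] Suc.prems by (simp add: b_def a_def)
  also have "\<dots> = (\<Sum>i<n. b ^ (n - i) * (a i * of_nat (k - 1) * \<phi> (2 * int i - int (Suc n))
       + of_nat (k - 2) * \<phi> (2 * int i + 1 - int (Suc n))))"
    unfolding sum_distrib_left
  proof (rule sum.cong[OF refl])
    fix i assume "i \<in> {..<n}"
    then have "n - i = Suc (n - 1 - i)" by auto
    then have "b ^ (n - i) = b * b ^ (n - 1 - i)" by simp
    then show "b * (b ^ (n - 1 - i) * (a i * of_nat (k - 1) * \<phi> (2 * int i - int n - 1)
         + of_nat (k - 2) * \<phi> (2 * int i + 1 - int n - 1))) =
       b ^ (n - i) * (a i * of_nat (k - 1) * \<phi> (2 * int i - int (Suc n))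
         + of_nat (k - 2) * \<phi> (2 * int i + 1 - int (Suc n)))"
      by (simp add: algebra_simps)
  qed
  finally have off: "(\<Sum>x\<in>S n - {\<omega> n}. c x) = \<dots>" .
  have "n < m" using Suc.prems by simp
  then obtain P1 where P1: "P1 \<in> child_polygons (\<omega> n)" "\<omega> (Suc n) \<in> \<Union>P1 - {\<omega> n}"
      "is_gate (\<omega> m) P1 (\<omega> (Suc n))"
    by (rule ray_polygon)
  have level: "int m - int (d (\<omega> n) (\<omega> m)) = int n" "int m - int (d (\<omega> (Suc n)) (\<omega> m)) = int n + 1"
    using Suc.prems ray_dist[of n m] ray_dist[of "Suc n" m] by (simp_all add: of_nat_diff)
  have "(\<Sum>y\<in>\<Union>P - {\<omega> n}. \<phi> (int m - int (d y (\<omega> m)))) = of_nat (k - 1) * \<phi> (int n - 1)"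
    if "P \<in> child_polygons (\<omega> n) - {P1}" for P
  proof -
    have "\<omega> (Suc n) \<notin> \<Union>P" using child_unique(1)[OF P1(1) _ P1(2)] that P1(2) by blast
    then have "is_gate (\<omega> m) P (\<omega> n)"
      using that Suc.prems by (intro ray_off_polygon_gate) (auto simp: child_polygons_def)
    then show ?thesis using that sum_children_gate[of P "\<omega> n" "\<omega> m" \<phi> "int m"] level by simp
  qed
  then have "(\<Sum>P\<in>child_polygons (\<omega> n) - {P1}. \<Sum>y\<in>\<Union>P - {\<omega> n}. \<phi> (int m - int (d y (\<omega> m))))
      = of_nat (card (child_polygons (\<omega> n) - {P1})) * (of_nat (k - 1) * \<phi> (int n - 1))"
    by simp
  \<comment> \<open>Besides the polygon crossed by the ray, the origin has r - 1 child polygons, and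
    a later node, which also has a polygon leading back, has r - 2.\<close>
  also have "card (child_polygons (\<omega> n) - {P1}) = (if n = 0 then r - 1 else r - 2)"
    using P1(1) ray_level[of n] by (auto simp: card_child_polygons ray_0)
  finally have other: "(\<Sum>P\<in>child_polygons (\<omega> n) - {P1}. \<Sum>y\<in>\<Union>P - {\<omega> n}. \<phi> (int m - int (d y (\<omega> m))))
      = a n * (of_nat (k - 1) * \<phi> (int n - 1))" by (simp add: a_def)
  \<comment> \<open>The k - 2 vertices of the crossed polygon other than the two nodes are as far
    from \<omega> m as \<omega> n is, so they stay on the horocycle of \<omega> n.\<close>
  have "d y (\<omega> m) = Suc (d (\<omega> (Suc n)) (\<omega> m))" if "y \<in> \<Union>P1 - {\<omega> n} - {\<omega> (Suc n)}" for y
    using that P1(3) unfolding dist_commute[of _ "\<omega> m"] is_gate_def by blast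
  then have "(\<Sum>y\<in>\<Union>P1 - {\<omega> n} - {\<omega> (Suc n)}. \<phi> (int m - int (d y (\<omega> m)))) =
      (\<Sum>y\<in>\<Union>P1 - {\<omega> n} - {\<omega> (Suc n)}. \<phi> (int n))"
    using level(2) by (intro sum.cong refl) (simp add: algebra_simps)
  also have "\<dots> = of_nat (k - 2) * \<phi> (int n)"
    using card_children[OF P1(1)] P1(2) finite_children[OF P1(1)] by (simp add: numeral_2_eq_2)
  finally have "(\<Sum>y\<in>\<Union>P1 - {\<omega> n}. \<phi> (int m - int (d y (\<omega> m)))) =
      \<phi> (int n + 1) + of_nat (k - 2) * \<phi> (int n)"
    using sum.remove[OF finite_children[OF P1(1)] P1(2), of "\<lambda>y. \<phi> (int m - int (d y (\<omega> m)))"] level(2)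
    by simp
  then have on: "c (\<omega> n) = \<phi> (int n + 1) + of_nat (k - 2) * \<phi> (int n) + a n * (of_nat (k - 1) * \<phi> (int n - 1))"
    unfolding c_def using other P1(1) by (subst sum.remove[of _ P1]) auto
  have "(\<Sum>x\<in>S (Suc n). \<phi> (int m - int (d x (\<omega> m)))) = c (\<omega> n) + (\<Sum>x\<in>S n - {\<omega> n}. c x)"
    unfolding sum_sphere_Suc c_def[symmetric] by (rule sum.remove) (auto simp: on_sphere)
  moreover have "(\<Sum>x\<in>S (Suc n). \<phi> (int m - int (d x (\<omega> m)))) =
      \<phi> (int n + 1) + (\<Sum>x\<in>S (Suc n) - {\<omega> (Suc n)}. \<phi> (int m - int (d x (\<omega> m))))"
    using sum.remove[OF _ on_sphere[of "Suc n"], of "\<lambda>x. \<phi> (int m - int (d x (\<omega> m)))"] level(2) by simp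
  ultimately have "(\<Sum>x\<in>S (Suc n) - {\<omega> (Suc n)}. \<phi> (int m - int (d x (\<omega> m)))) =
      a n * (of_nat (k - 1) * \<phi> (int n - 1)) + of_nat (k - 2) * \<phi> (int n) + (\<Sum>x\<in>S n - {\<omega> n}. c x)"
    using on by simp
  then show ?case unfolding off b_def[symmetric] a_def[symmetric] by (simp add: algebra_simps)
qed

end

end


section \<open>The recurrence and its inversion\<close>

text \<open>Collects the terms of the duality sum for which |h| equals a given value: two if it is
  positive, one if it is zero, none if it is negative.\<close>

definition fold_even :: "(int \<Rightarrow> complex) \<Rightarrow> int \<Rightarrow> complex" where
  "fold_even g h = (if h < 0 then 0 else if h = 0 then g 0 else 2 * g h)"

lemma fold_even_neg: "h < 0 \<Longrightarrow> fold_even g h = 0"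
  by (simp add: fold_even_def)

text \<open>For even \<open>g\<close>, \<open>parity_sum g n\<close> is the sum of \<open>g h\<close> over \<open>\<bar>h\<bar> < n\<close> with \<open>h \<equiv> n\<close> modulo 2.\<close>

fun parity_sum :: "(int \<Rightarrow> complex) \<Rightarrow> nat \<Rightarrow> complex" where
  "parity_sum g 0 = 0"
| "parity_sum g (Suc 0) = 0"
| "parity_sum g (Suc (Suc n)) = parity_sum g n + fold_even g (int n)"

text \<open>Going from n to n + 2 and shifting i by one adds a lowest term, which vanishes because
  its argument is negative, and the top term \<open>fold_even g n\<close>.\<close>

lemma sum_fold_even_same_parity: "(\<Sum>i<n. fold_even g (2 * int i - int n)) = parity_sum g n"
proof (induction g n rule: parity_sum.induct)
  case (3 g n)
  have "(\<Sum>i<Suc (Suc n). fold_even g (2 * int i - int (Suc (Suc n)))) =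
      fold_even g (- int (Suc (Suc n))) + (\<Sum>i<Suc n. fold_even g (2 * int (Suc i) - int (Suc (Suc n))))"
    by (subst sum.lessThan_Suc_shift) simp
  also have "\<dots> = (\<Sum>i<Suc n. fold_even g (2 * int i - int n))"
    by (simp add: fold_even_neg algebra_simps)
  finally show ?case using 3 by simp
qed (simp_all add: fold_even_def)

lemma sum_fold_even_other_parity: "(\<Sum>i<n. fold_even g (2 * int i + 1 - int n)) = parity_sum g (Suc n)"
proof -
  have "parity_sum g (Suc n) = fold_even g (- int (Suc n)) + (\<Sum>i<n. fold_even g (2 * int (Suc i) - int (Suc n)))"
    unfolding sum_fold_even_same_parity[symmetric] by (subst sum.lessThan_Suc_shift) simp
  then show ?thesis by (simp add: fold_even_neg algebra_simps)
qed

text \<open>\<open>K\<close> and \<open>R\<close> stand for k and r, and \<open>q\<close> for the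
  square root of Q, so that half-integral powers of Q become natural powers of
  \<open>q\<close>.\<close>

locale abel_parameters =
  fixes K R q :: complex
  assumes q2: "q ^ 2 = (R - 1) * (K - 1)" and q_nz: "q \<noteq> 0" and K_nz: "K \<noteq> 0"
begin

text \<open>The value of the dual Abel transform at \<open>n\<close>, multiplied by the size of the sphere.\<close>

definition dual_seq :: "(int \<Rightarrow> complex) \<Rightarrow> nat \<Rightarrow> complex" where
  "dual_seq g n = q ^ n * (fold_even g (int n) + (R - 2) * (K - 1) / q ^ 2 * parity_sum g n
     + (K - 2) / q * parity_sum g (Suc n))"

text \<open>As (R-2)(K-1) = q^2 - (K-1), the q^2-multiple of the parity sum at n cancels against the
  one in \<open>fold_even g n\<close>, which is the difference of the parity sums at n + 2 and
  n.\<close>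

lemma dual_seq_recurrence:
  "q ^ 2 * dual_seq g n = q ^ Suc (Suc n) * parity_sum g (Suc (Suc n))
     + (K - 2) * (q ^ Suc n * parity_sum g (Suc n)) - (K - 1) * (q ^ n * parity_sum g n)"
proof -
  have "q ^ 2 * dual_seq g n = q ^ n * (q ^ 2 * fold_even g (int n) + (R - 2) * (K - 1) * parity_sum g n
     + (K - 2) * q * parity_sum g (Suc n))"
    using q_nz by (simp add: dual_seq_def field_simps power2_eq_square)
  also have "(R - 2) * (K - 1) = q ^ 2 - (K - 1)" by (simp add: q2 algebra_simps)
  finally show ?thesis by (simp add: algebra_simps power2_eq_square)
qed

text \<open>The characteristic roots of the recurrence are \<open>1\<close> and \<open>1 - K\<close>.\<close>

definition green :: "nat \<Rightarrow> complex" where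
  "green m = (1 - (1 - K) ^ m) / K"

text \<open>Variation of constants: \<open>green\<close> is the response to a unit impulse, with
  values 0 and 1 at 0 and 1. The index is n - 1 - j because the recurrence lets \<open>w j\<close>
  act first at j + 2.\<close>

definition solution :: "(nat \<Rightarrow> complex) \<Rightarrow> nat \<Rightarrow> complex" where
  "solution w n = (\<Sum>j<n. green (n - 1 - j) * (q ^ 2 * w j))"

lemma green_simps [simp]: "green 0 = 0" "green (Suc 0) = 1" "green 2 = 2 - K"
  using K_nz by (simp_all add: green_def field_simps power2_eq_square)

lemma green_rec: "green (Suc (Suc m)) = (K - 1) * green m - (K - 2) * green (Suc m)"
  using K_nz by (simp add: green_def field_simps)

lemma solution_recurrence:
  "solution w (Suc (Suc n)) = q ^ 2 * w n - (K - 2) * solution w (Suc n) + (K - 1) * solution w n"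
proof -
  have "(\<Sum>j<n. green (Suc n - j) * (q ^ 2 * w j)) =
      (\<Sum>j<n. (K - 1) * (green (n - 1 - j) * (q ^ 2 * w j)) - (K - 2) * (green (n - j) * (q ^ 2 * w j)))"
  proof (rule sum.cong[OF refl])
    fix j assume "j \<in> {..<n}"
    then have "Suc n - j = Suc (Suc (n - 1 - j))" "n - j = Suc (n - 1 - j)" by auto
    then show "green (Suc n - j) * (q ^ 2 * w j) =
        (K - 1) * (green (n - 1 - j) * (q ^ 2 * w j)) - (K - 2) * (green (n - j) * (q ^ 2 * w j))"
      by (simp add: green_rec algebra_simps)
  qed
  then show ?thesis
    by (simp add: solution_def sum_subtractf sum_distrib_left)
qed

text \<open>Both sides vanish at 0 and 1 and satisfy the same recurrence of order two.\<close>

lemma dual_seq_imp_solution: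
  assumes "\<And>n. dual_seq g n = w n"
  shows "q ^ n * parity_sum g n = solution w n"
proof (induction n rule: induct_nat_012)
  case (ge2 n)
  then show ?case
    using dual_seq_recurrence[of g n] unfolding assms solution_recurrence by (simp only:) (simp add: algebra_simps)
qed (simp_all add: solution_def)

lemma solution_imp_dual_seq:
  assumes "\<And>n. q ^ n * parity_sum g n = solution w n"
  shows "dual_seq g n = w n"
proof -
  have "q ^ 2 * dual_seq g n = q ^ 2 * w n"
    unfolding dual_seq_recurrence assms solution_recurrence by (simp add: algebra_simps)
  then show ?thesis using q_nz by simp
qed

lemma dual_seq_0: "dual_seq g 0 = g 0"
  by (simp add: dual_seq_def fold_even_def)

lemma dual_seq_surj:
  obtains g where "\<And>h. g (- h) = g h" "\<And>n. dual_seq g n = w n"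
proof -
  \<comment> \<open>The required value of \<open>fold_even g n\<close>, namely the difference of the
    parity sums at n + 2 and n, each read off from \<open>solution w\<close> after division by its
    power of \<open>q\<close>.\<close>
  define \<gamma> where "\<gamma> n = (solution w (Suc (Suc n)) / q ^ 2 - solution w n) / q ^ n" for n
  define g where "g h = (if h = 0 then \<gamma> 0 else \<gamma> (nat \<bar>h\<bar>) / 2)" for h :: int
  have \<gamma>: "fold_even g (int n) = \<gamma> n" for n by (simp add: fold_even_def g_def)
  have "q ^ n * parity_sum g n = solution w n" for n
  proof (induction n rule: induct_nat_012)
    case (ge2 n)
    then show ?case using q_nz by (simp add: \<gamma>) (simp add: \<gamma>_def field_simps power2_eq_square)
  qed (simp_all add: solution_def)
  then have "dual_seq g n = w n" for n by (rule solution_imp_dual_seq)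
  moreover have "g (- h) = g h" for h by (simp add: g_def)
  ultimately show ?thesis using that by blast
qed

text \<open>The factor K - 1 of q^2 raises (1-K)^(i-1) to -(1-K)^i; collecting terms gives the
  coefficient of the inversion formula.\<close>

lemma green_diff:
  assumes "i > 0"
  shows "green (Suc i) - q ^ 2 * green (i - 1) = - (q ^ 2 - 1 + (R - K) * (1 - K) ^ i) / K"
proof -
  obtain l where i: "i = Suc l" using assms gr0_implies_Suc by blast
  show ?thesis unfolding i q2 green_def using K_nz by (simp add: field_simps)
qed

lemma dual_seq_inverse:
  assumes "\<And>n. dual_seq g n = w n" "n \<ge> 1"
  shows "2 * g (int n) * q ^ n = w n - (K - 2) * w (n - 1)
     - (\<Sum>j<n - 1. (q ^ 2 - 1 + (R - K) * (1 - K) ^ (n - j)) / K * w j)"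
proof -
  obtain m where n: "n = Suc m" using assms(2) by (cases n) auto
  have "2 * g (int n) = parity_sum g (Suc (Suc n)) - parity_sum g n"
    using assms(2) by (simp add: fold_even_def)
  then have "q ^ 2 * (2 * g (int n) * q ^ n) = solution w (Suc (Suc n)) - q ^ 2 * solution w n"
    using dual_seq_imp_solution[OF assms(1), of "Suc (Suc n)"] dual_seq_imp_solution[OF assms(1), of n]
    by (simp add: algebra_simps power2_eq_square)
  also have "\<dots> = q ^ 2 * ((\<Sum>j<Suc (Suc n). green (Suc n - j) * w j) - q ^ 2 * (\<Sum>j<n. green (n - 1 - j) * w j))"
    by (simp add: solution_def algebra_simps sum_distrib_left)
  finally have "2 * g (int n) * q ^ n =
      (\<Sum>j<Suc (Suc n). green (Suc n - j) * w j) - q ^ 2 * (\<Sum>j<n. green (n - 1 - j) * w j)"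
    using q_nz by simp
  \<comment> \<open>The top indices n + 1, n and n - 1 of the first sum meet \<open>green\<close> at
    0, 1 and 2, with values 0, 1 and 2 - K; in the second sum the index n - 1 meets
    \<open>green 0 = 0\<close>.\<close>
  also have "\<dots> = w n - (K - 2) * w m + (\<Sum>j<m. (green (Suc n - j) - q ^ 2 * green (n - 1 - j)) * w j)"
    by (simp add: n algebra_simps sum_subtractf sum_distrib_left flip: numeral_2_eq_2)
  also have "(\<Sum>j<m. (green (Suc n - j) - q ^ 2 * green (n - 1 - j)) * w j) =
      (\<Sum>j<m. - ((q ^ 2 - 1 + (R - K) * (1 - K) ^ (n - j)) / K * w j))"
  proof (rule sum.cong[OF refl])
    fix j assume "j \<in> {..<m}"
    then have "Suc n - j = Suc (n - j)" "n - 1 - j = n - j - 1" "n - j > 0" by (auto simp: n)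
    then show "(green (Suc n - j) - q ^ 2 * green (n - 1 - j)) * w j =
        - ((q ^ 2 - 1 + (R - K) * (1 - K) ^ (n - j)) / K * w j)"
      by (simp only: green_diff minus_divide_left[symmetric] mult_minus_left)
  qed
  finally show ?thesis by (simp add: n sum_negf)
qed

end


section \<open>The dual Abel transform\<close>

context rooted_symmetric_graph
begin

abbreviation (input) "q \<equiv> complex_of_real (sqrt (branching k r))"

lemma branching_pos: "branching k r > 0"
  using k_ge r_ge by (simp add: branching_def)

lemma of_nat_branching: "of_nat ((r - 1) * (k - 1)) = complex_of_real (branching k r)"
  using k_ge r_ge by (simp add: branching_def of_nat_diff)

sublocale abel_parameters "of_nat k" "of_nat r" q
proof
  have "q ^ 2 = of_real (branching k r)"
    using branching_pos by (simp flip: of_real_power)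
  then show "q ^ 2 = (of_nat r - 1) * (of_nat k - 1)"
    by (simp add: branching_def)
  show "q \<noteq> 0" "of_nat k \<noteq> (0::complex)" using branching_pos k_ge by auto
qed

text \<open>What a single vertex of Busemann value h contributes to the duality sum. For h < 0 the
  exponent \<open>nat h\<close> is truncated to 0, but there \<open>fold_even\<close>
  vanishes.\<close>

definition horocycle_weight :: "(int \<Rightarrow> complex) \<Rightarrow> int \<Rightarrow> complex" where
  "horocycle_weight g h = q ^ nat h * fold_even g h"

text \<open>The number of descendants grows like Q^(n-1-i), and multiplying by Q^(h/2) with h = 2i -
  n or h = 2i + 1 - n gives Q^(n/2-1) or Q^((n-1)/2), independently of i. Only unweighted parity
  sums remain.\<close>

lemma sum_sphere_horocycle_weight:
  assumes \<omega>: "\<omega> \<in> boundary E k org" and "n \<le> m"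
  shows "(\<Sum>x\<in>S n. horocycle_weight g (int m - int (d x (\<omega> m)))) = dual_seq g n"
proof -
  let ?\<phi> = "horocycle_weight g"
  let ?b = "of_nat ((r - 1) * (k - 1)) :: complex"
  have b: "?b = q ^ 2" using of_nat_branching branching_pos by (simp flip: of_real_power)
  have pow: "?b ^ (n - 1 - i) * ?\<phi> (2 * int i - int n) = q ^ n / q ^ 2 * fold_even g (2 * int i - int n)"
    if "i < n" for i
  proof (cases "2 * int i - int n < 0")
    case False
    then have "2 * (n - 1 - i) + nat (2 * int i - int n) + 2 = n" using that by linarith
    then have "q ^ n = ?b ^ (n - 1 - i) * q ^ nat (2 * int i - int n) * q ^ 2"
      unfolding b by (metis power_add power_mult)
    then show ?thesis using q_nz by (simp add: horocycle_weight_def)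
  qed (simp add: horocycle_weight_def fold_even_neg)
  have pow': "?b ^ (n - 1 - i) * ?\<phi> (2 * int i + 1 - int n) = q ^ n / q * fold_even g (2 * int i + 1 - int n)"
    if "i < n" for i
  proof (cases "2 * int i + 1 - int n < 0")
    case False
    then have "2 * (n - 1 - i) + nat (2 * int i + 1 - int n) + 1 = n" using that by linarith
    then have "q ^ n = ?b ^ (n - 1 - i) * q ^ nat (2 * int i + 1 - int n) * q"
      unfolding b by (metis power_add power_mult power_one_right)
    then show ?thesis using q_nz by (simp add: horocycle_weight_def)
  qed (simp add: horocycle_weight_def fold_even_neg)
  have "\<omega> n \<in> S n" by (simp add: mem_sphere_iff ray_level[OF \<omega>])
  then have "(\<Sum>x\<in>S n. ?\<phi> (int m - int (d x (\<omega> m)))) =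
      ?\<phi> (int m - int (d (\<omega> n) (\<omega> m))) + (\<Sum>x\<in>S n - {\<omega> n}. ?\<phi> (int m - int (d x (\<omega> m))))"
    by (intro sum.remove) auto
  also have "int m - int (d (\<omega> n) (\<omega> m)) = int n"
    using ray_dist[OF \<omega> assms(2)] assms(2) by (simp add: of_nat_diff)
  also have "(\<Sum>x\<in>S n - {\<omega> n}. ?\<phi> (int m - int (d x (\<omega> m)))) =
      (\<Sum>i<n. (of_nat r - 2) * (of_nat k - 1) * (q ^ n / q ^ 2) * fold_even g (2 * int i - int n)
         + (of_nat k - 2) * (q ^ n / q) * fold_even g (2 * int i + 1 - int n))"
    unfolding sum_sphere_off_ray[OF \<omega> assms(2)]
  proof (rule sum.cong[OF refl])
    fix i assume "i \<in> {..<n}"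
    then have i: "i < n" by simp
    \<comment> \<open>The exceptional count r - 1 at i = 0 belongs to the negative argument -n,
      where \<open>fold_even\<close> vanishes.\<close>
    have "of_nat (if i = 0 then r - 1 else r - 2) * fold_even g (2 * int i - int n) =
        (of_nat r - 2) * fold_even g (2 * int i - int n)"
      using i r_ge by (cases "i = 0") (simp_all add: fold_even_neg of_nat_diff)
    then have "of_nat (if i = 0 then r - 1 else r - 2) * (?b ^ (n - 1 - i) * ?\<phi> (2 * int i - int n)) =
        (of_nat r - 2) * (q ^ n / q ^ 2 * fold_even g (2 * int i - int n))"
      unfolding pow[OF i] by (simp add: mult.left_commute)
    moreover have "of_nat (k - 1) = (of_nat k - 1 :: complex)" "of_nat (k - 2) = (of_nat k - 2 :: complex)"
      using k_ge by (simp_all add: of_nat_diff)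
    ultimately show "?b ^ (n - 1 - i) *
          (of_nat (if i = 0 then r - 1 else r - 2) * of_nat (k - 1) * ?\<phi> (2 * int i - int n)
           + of_nat (k - 2) * ?\<phi> (2 * int i + 1 - int n)) =
        (of_nat r - 2) * (of_nat k - 1) * (q ^ n / q ^ 2) * fold_even g (2 * int i - int n)
          + (of_nat k - 2) * (q ^ n / q) * fold_even g (2 * int i + 1 - int n)"
      using pow'[OF i] by (simp only: distrib_left mult_ac)
  qed
  also have "\<dots> = (of_nat r - 2) * (of_nat k - 1) * (q ^ n / q ^ 2) * parity_sum g n
      + (of_nat k - 2) * (q ^ n / q) * parity_sum g (Suc n)"
    by (simp only: sum.distrib sum_distrib_left[symmetric] sum_fold_even_same_parity sum_fold_even_other_parity)
  also have "?\<phi> (int n) + \<dots> = dual_seq g n"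
    using branching_pos by (simp add: horocycle_weight_def dual_seq_def field_simps)
  finally show ?thesis .
qed

section \<open>Radial functions and the duality, sphere by sphere\<close>

lemma radial_value_eq:
  assumes "F \<in> radial_functions E k org" "x \<in> S n"
  shows "radial_value E k org F n = F x"
proof -
  have "(SOME x. x \<in> S n) \<in> S n" using assms(2) by (rule someI)
  then show ?thesis using assms unfolding radial_value_def radial_functions_def
    by (auto simp: gsphere_def)
qed

lemma radial_of_seq:
  "(\<lambda>x. s (d org x)) \<in> radial_functions E k org"
  "radial_value E k org (\<lambda>x. s (d org x)) n = s n"
proof -
  show rad: "(\<lambda>x. s (d org x)) \<in> radial_functions E k org"
    by (auto simp: radial_functions_def dist_commute[of _ org])
  obtain x where x: "x \<in> S n" using sphere_nonempty by blast
  then show "radial_value E k org (\<lambda>x. s (d org x)) n = s n"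
    using radial_value_eq[OF rad x] by (simp add: mem_sphere_iff)
qed

lemma radial_ext:
  assumes "F \<in> radial_functions E k org" "G \<in> radial_functions E k org"
    "\<And>n. radial_value E k org F n = radial_value E k org G n"
  shows "F = G"
proof
  fix x
  have "x \<in> S (d org x)" by (simp add: mem_sphere_iff)
  then show "F x = G x" using radial_value_eq assms by metis
qed

lemma test_function_support:
  assumes "f \<in> test_functions E k org"
  obtains N where "\<And>x. d org x > N \<Longrightarrow> f x = 0"
proof -
  have fin: "finite (d org ` {x. f x \<noteq> 0})" using assms by (simp add: test_functions_def)
  have "f x = 0" if "d org x > Max (d org ` {x. f x \<noteq> 0})" for x
    using Max_ge[OF fin, of "d org x"] that by force
  then show ?thesis using that by blast
qed

text \<open>The indices that contribute are b and -b, which coincide for b = 0; for b < 0 there are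
  none.\<close>

lemma sum_abs_eq:
  fixes \<psi> :: "int \<Rightarrow> complex"
  assumes "b \<le> int N"
  shows "(\<Sum>h\<in>{- int N..int N}. if b = \<bar>h\<bar> then \<psi> \<bar>h\<bar> else 0) = fold_even \<psi> b"
proof -
  have "(\<Sum>h\<in>{- int N..int N}. if b = \<bar>h\<bar> then \<psi> \<bar>h\<bar> else 0) =
      (\<Sum>h\<in>(if b < 0 then {} else {b, - b}). \<psi> b)"
    by (intro sum.mono_neutral_cong_right) (use assms in \<open>auto split: if_splits\<close>)
  then show ?thesis by (auto simp: fold_even_def)
qed

text \<open>The Busemann value is at most the distance from the origin, so the support of
  \<open>f\<close> bounds both the vertices and the horocycles involved. After exchanging the finite
  sums, each vertex contributes through its Busemann value alone.\<close>

lemma infsum_abel: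
  assumes \<omega>: "\<omega> \<in> boundary E k org" and f: "f \<in> test_functions E k org"
    and N: "\<And>x. d org x > N \<Longrightarrow> f x = 0"
  shows "(\<Sum>\<^sub>\<infinity>h\<in>UNIV. g \<bar>h\<bar> * abel E k r org \<omega> f \<bar>h\<bar>) =
    (\<Sum>n\<le>N. radial_value E k org f n * dual_seq g n)"
proof -
  define B where "B = (\<Union>n\<le>N. S n)"
  let ?\<zeta> = "\<lambda>x. busemann E k org x \<omega>"
  have mem_B: "x \<in> B \<longleftrightarrow> d org x \<le> N" for x by (auto simp: B_def mem_sphere_iff)
  have fin: "finite B" by (simp add: B_def)
  \<comment> \<open>One node, \<omega> (Suc n), serves for the whole sphere of radius n, so the sum
    over that sphere has the form treated in \<open>sum_sphere_horocycle_weight\<close>.\<close>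
  have bus: "?\<zeta> x = int (Suc n) - int (d x (\<omega> (Suc n)))" if "x \<in> S n" for x n
    using that by (simp add: busemann_def ray_level[OF \<omega>] mem_sphere_iff dist_commute[of x org])
  have bus_le: "?\<zeta> x \<le> int N" if x: "x \<in> B" for x
  proof -
    obtain n where n: "n \<le> N" "x \<in> S n" using x by (auto simp: B_def)
    then show ?thesis
      using dist_triangle[of org "\<omega> (Suc n)" x] bus[OF n(2)] by (simp add: ray_level[OF \<omega>] mem_sphere_iff)
  qed
  define \<psi> where "\<psi> h = g h * q ^ nat h" for h
  have abel: "g \<bar>h\<bar> * abel E k r org \<omega> f \<bar>h\<bar> = (\<Sum>x\<in>B. if ?\<zeta> x = \<bar>h\<bar> then \<psi> \<bar>h\<bar> * f x else 0)" for h
  proof -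
    have "branching k r powr (of_int \<bar>h\<bar> / 2) = sqrt (branching k r) ^ nat \<bar>h\<bar>"
      using branching_pos
      by (simp add: powr_half_sqrt[symmetric] powr_powr flip: powr_realpow)
    moreover have "(\<Sum>\<^sub>\<infinity>x\<in>horocycle E k org \<bar>h\<bar> \<omega>. f x) = (\<Sum>\<^sub>\<infinity>x\<in>{x \<in> B. ?\<zeta> x = \<bar>h\<bar>}. f x)"
      using N by (intro infsum_cong_neutral) (auto simp: horocycle_def mem_B not_le)
    ultimately show ?thesis
      using fin by (simp add: abel_def \<psi>_def sum.inter_filter sum_distrib_left if_distrib mult.assoc cong: if_cong)
  qed
  have "(\<Sum>\<^sub>\<infinity>h\<in>UNIV. g \<bar>h\<bar> * abel E k r org \<omega> f \<bar>h\<bar>) =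
      (\<Sum>\<^sub>\<infinity>h\<in>{- int N..int N}. g \<bar>h\<bar> * abel E k r org \<omega> f \<bar>h\<bar>)"
  proof (rule infsum_cong_neutral)
    fix h assume "h \<in> UNIV - {- int N..int N}"
    then have "\<bar>h\<bar> > int N" by auto
    then have "?\<zeta> x \<noteq> \<bar>h\<bar>" if "x \<in> B" for x using bus_le[OF that] by simp
    then show "g \<bar>h\<bar> * abel E k r org \<omega> f \<bar>h\<bar> = 0" unfolding abel by (intro sum.neutral) auto
  qed auto
  also have "\<dots> = (\<Sum>h\<in>{- int N..int N}. \<Sum>x\<in>B. if ?\<zeta> x = \<bar>h\<bar> then \<psi> \<bar>h\<bar> * f x else 0)"
    by (simp add: abel)
  also have "\<dots> = (\<Sum>x\<in>B. \<Sum>h\<in>{- int N..int N}. if ?\<zeta> x = \<bar>h\<bar> then \<psi> \<bar>h\<bar> * f x else 0)"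
    by (rule sum.swap)
  also have "\<dots> = (\<Sum>x\<in>B. f x * fold_even \<psi> (?\<zeta> x))"
  proof (rule sum.cong[OF refl])
    fix x assume "x \<in> B"
    note le = bus_le[OF this]
    show "(\<Sum>h\<in>{- int N..int N}. if ?\<zeta> x = \<bar>h\<bar> then \<psi> \<bar>h\<bar> * f x else 0) = f x * fold_even \<psi> (?\<zeta> x)"
      unfolding sum_abs_eq[OF le, symmetric] sum_distrib_left by (intro sum.cong) auto
  qed
  also have "\<dots> = (\<Sum>n\<le>N. \<Sum>x\<in>S n. f x * fold_even \<psi> (?\<zeta> x))"
    unfolding B_def by (rule sum.UNION_disjoint) (auto simp: mem_sphere_iff)
  also have "\<dots> = (\<Sum>n\<le>N. radial_value E k org f n * dual_seq g n)"
  proof (rule sum.cong[OF refl])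
    fix n
    have "(\<Sum>x\<in>S n. f x * fold_even \<psi> (?\<zeta> x)) =
        (\<Sum>x\<in>S n. radial_value E k org f n * horocycle_weight g (int (Suc n) - int (d x (\<omega> (Suc n)))))"
    proof (rule sum.cong[OF refl])
      fix x assume x: "x \<in> S n"
      have "f x = radial_value E k org f n"
        using radial_value_eq[OF _ x] f by (simp add: test_functions_def)
      moreover have "fold_even \<psi> h = horocycle_weight g h" for h
        by (simp add: fold_even_def \<psi>_def horocycle_weight_def)
      ultimately show "f x * fold_even \<psi> (?\<zeta> x) =
          radial_value E k org f n * horocycle_weight g (int (Suc n) - int (d x (\<omega> (Suc n))))"
        by (simp only: bus[OF x])
    qed
    then show "(\<Sum>x\<in>S n. f x * fold_even \<psi> (?\<zeta> x)) = radial_value E k org f n * dual_seq g n"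
      using sum_sphere_horocycle_weight[OF \<omega>, of n "Suc n" g] by (simp only: sum_distrib_left[symmetric])
  qed
  finally show ?thesis .
qed

lemma is_dual_abel_iff:
  "is_dual_abel E k r org g F \<longleftrightarrow> F \<in> radial_functions E k org \<and>
    (\<forall>n. radial_value E k org F n * of_nat (card (S n)) = dual_seq g n)"
    (is "?L \<longleftrightarrow> ?R")
proof -
  have lhs: "(\<Sum>\<^sub>\<infinity>n\<in>UNIV. radial_value E k org F n * radial_value E k org f n * of_nat (card (S n))) =
      (\<Sum>n\<le>N. radial_value E k org f n * (radial_value E k org F n * of_nat (card (S n))))"
    if f: "f \<in> test_functions E k org" "\<And>x. d org x > N \<Longrightarrow> f x = 0" for f N
  proof -
    have "radial_value E k org f n = 0" if n: "n > N" for n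
    proof -
      obtain x where x: "x \<in> S n" using sphere_nonempty by blast
      then show ?thesis using radial_value_eq[OF _ x] f n by (simp add: test_functions_def mem_sphere_iff)
    qed
    then have "(\<Sum>\<^sub>\<infinity>n\<in>UNIV. radial_value E k org F n * radial_value E k org f n * of_nat (card (S n))) =
        (\<Sum>\<^sub>\<infinity>n\<in>{..N}. radial_value E k org f n * (radial_value E k org F n * of_nat (card (S n))))"
      by (intro infsum_cong_neutral) (auto simp: not_le)
    then show ?thesis by simp
  qed
  show ?thesis
  proof
    assume L: ?L
    then have rad: "F \<in> radial_functions E k org" by (simp add: is_dual_abel_def)
    moreover have "radial_value E k org F n * of_nat (card (S n)) = dual_seq g n" for n
    proof -
      obtain \<omega> where \<omega>: "\<omega> \<in> boundary E k org" using boundary_nonempty by blast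
      \<comment> \<open>The indicator function of a single sphere isolates the n-th
        coefficient.\<close>
      define s :: "nat \<Rightarrow> complex" where "s j = (if j = n then 1 else 0)" for j
      define f where "f x = s (d org x)" for x
      have "{x. f x \<noteq> 0} = S n" by (auto simp: f_def s_def mem_sphere_iff)
      then have f: "f \<in> test_functions E k org"
        using radial_of_seq(1)[of s] by (simp add: test_functions_def f_def[abs_def])
      have f0: "f x = 0" if "d org x > n" for x using that by (simp add: f_def s_def)
      have rv: "radial_value E k org f j = s j" for j
        using radial_of_seq(2)[of s] by (simp add: f_def[abs_def])
      have "(\<Sum>j\<le>n. s j * (radial_value E k org F j * of_nat (card (S j)))) =
          (\<Sum>\<^sub>\<infinity>n\<in>UNIV. radial_value E k org F n * radial_value E k org f n * of_nat (card (S n)))"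
        unfolding rv[symmetric] by (rule lhs[OF f f0, symmetric])
      also have "\<dots> = (\<Sum>\<^sub>\<infinity>h\<in>UNIV. g \<bar>h\<bar> * abel E k r org \<omega> f \<bar>h\<bar>)"
        using L \<omega> f unfolding is_dual_abel_def by blast
      also have "\<dots> = (\<Sum>j\<le>n. s j * dual_seq g j)"
        unfolding rv[symmetric] by (rule infsum_abel[OF \<omega> f f0])
      finally have "(\<Sum>j\<le>n. s j * (radial_value E k org F j * of_nat (card (S j)))) =
          (\<Sum>j\<le>n. s j * dual_seq g j)" .
      moreover have "(\<Sum>j\<le>n. s j * t j) = t n" for t :: "nat \<Rightarrow> complex"
        by (simp add: s_def if_distrib[of "\<lambda>c. c * _"] cong: if_cong)
      ultimately show ?thesis by simp
    qed
    ultimately show ?R by blast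
  next
    assume R: ?R
    have "(\<Sum>\<^sub>\<infinity>n\<in>UNIV. radial_value E k org F n * radial_value E k org f n * of_nat (card (S n))) =
        (\<Sum>\<^sub>\<infinity>h\<in>UNIV. g \<bar>h\<bar> * abel E k r org \<omega> f \<bar>h\<bar>)"
      if \<omega>: "\<omega> \<in> boundary E k org" and f: "f \<in> test_functions E k org" for \<omega> f
    proof -
      obtain N where N: "\<And>x. d org x > N \<Longrightarrow> f x = 0" using test_function_support[OF f] by blast
      have "(\<Sum>\<^sub>\<infinity>n\<in>UNIV. radial_value E k org F n * radial_value E k org f n * of_nat (card (S n))) =
          (\<Sum>n\<le>N. radial_value E k org f n * dual_seq g n)"
        using lhs[OF f N] R by simp
      then show ?thesis using infsum_abel[OF \<omega> f N] by (rule trans[OF _ sym])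
    qed
    then show ?L using R unfolding is_dual_abel_def by blast
  qed
qed

text \<open>Spheres are nonempty and finite, so their sizes can be divided out; this gives existence
  and uniqueness, which the description operator requires.\<close>

lemma dual_abel_eq: "dual_abel E k r org g = (\<lambda>x. dual_seq g (d org x) / of_nat (card (S (d org x))))"
proof -
  define F where "F = (\<lambda>x. dual_seq g (d org x) / of_nat (card (S (d org x))))"
  have nz: "of_nat (card (S n)) \<noteq> (0::complex)" for n using sphere_nonempty by simp
  have F: "F \<in> radial_functions E k org" "radial_value E k org F n = dual_seq g n / of_nat (card (S n))" for n
    using radial_of_seq[of "\<lambda>n. dual_seq g n / of_nat (card (S n))"] by (auto simp: F_def)
  then have "is_dual_abel E k r org g F" using nz by (simp add: is_dual_abel_iff)
  moreover have "G = F" if "is_dual_abel E k r org g G" for G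
  proof (rule radial_ext)
    show "radial_value E k org G n = radial_value E k org F n" for n
      using that unfolding F(2) is_dual_abel_iff nonzero_eq_divide_eq[OF nz] by blast
  qed (use that F in \<open>simp_all add: is_dual_abel_iff\<close>)
  ultimately show ?thesis unfolding dual_abel_def F_def[symmetric] by (rule the_equality)
qed

lemma dual_abel_eq_iff:
  assumes "F \<in> radial_functions E k org"
  shows "dual_abel E k r org g = F \<longleftrightarrow> (\<forall>n. dual_seq g n = radial_value E k org F n * of_nat (card (S n)))"
proof -
  have nz: "of_nat (card (S n)) \<noteq> (0::complex)" for n using sphere_nonempty by simp
  have rad: "dual_abel E k r org g \<in> radial_functions E k org"
    "radial_value E k org (dual_abel E k r org g) n = dual_seq g n / of_nat (card (S n))" for n
    using radial_of_seq[of "\<lambda>n. dual_seq g n / of_nat (card (S n))"] by (simp_all add: dual_abel_eq)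
  show ?thesis
    using radial_ext[OF rad(1) assms] rad(2) nz by (auto simp: divide_eq_eq)
qed

section \<open>Bijectivity and the inversion formula\<close>

lemma card_sphere: "of_nat (card (S n)) =
    (if n = 0 then 1 else of_nat r * (of_nat k - 1) * q ^ (2 * (n - 1)) :: complex)"
proof (cases n)
  case (Suc m)
  have "q ^ (2 * m) = of_nat ((r - 1) * (k - 1)) ^ m"
    unfolding of_nat_branching power_mult using branching_pos by (simp flip: of_real_power)
  then show ?thesis using k_ge by (simp add: Suc card_sphere_Suc of_nat_diff)
qed (simp add: sphere_0)

text \<open>\<open>dual_seq_0\<close> and \<open>dual_seq_inverse\<close> recover the values at h
  \<ge> 0, and evenness recovers the others.\<close>

lemma inj_on_dual_abel: "inj_on (dual_abel E k r org) even_functions"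
proof (rule inj_onI)
  fix g g' assume g: "g \<in> even_functions" "g' \<in> even_functions"
    "dual_abel E k r org g = dual_abel E k r org g'"
  define w where "w = dual_seq g"
  have "dual_abel E k r org g' \<in> radial_functions E k org"
    unfolding dual_abel_eq by (rule radial_of_seq)
  then have w: "dual_seq g n = w n" "dual_seq g' n = w n" for n
    using g(3) dual_abel_eq_iff by (auto simp: w_def)
  have nat: "g (int n) = g' (int n)" for n
  proof (cases "n = 0")
    case True
    then show ?thesis using w[of 0] by (simp add: dual_seq_0)
  next
    case False
    then have "2 * g (int n) * q ^ n = 2 * g' (int n) * q ^ n"
      using dual_seq_inverse[of g w n] dual_seq_inverse[of g' w n] w by simp
    then show ?thesis using q_nz by simp
  qed
  show "g = g'"
  proof
    fix h :: int
    have "g h = g \<bar>h\<bar>" "g' h = g' \<bar>h\<bar>" using g by (simp_all add: even_functions_def abs_if)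
    then show "g h = g' h" using nat[of "nat \<bar>h\<bar>"] by simp
  qed
qed

lemma bij_betw_dual_abel: "bij_betw (dual_abel E k r org) even_functions (radial_functions E k org)"
proof (rule bij_betw_imageI[OF inj_on_dual_abel])
  have "F \<in> dual_abel E k r org ` even_functions" if F: "F \<in> radial_functions E k org" for F
  proof -
    obtain g where g: "\<And>h. g (- h) = g h"
        "\<And>n. dual_seq g n = radial_value E k org F n * of_nat (card (S n))"
      by (rule dual_seq_surj[of "\<lambda>n. radial_value E k org F n * of_nat (card (S n))"]) blast
    then have "dual_abel E k r org g = F" by (simp add: dual_abel_eq_iff[OF F])
    then show ?thesis using g(1) by (auto simp: even_functions_def)
  qed
  moreover have "dual_abel E k r org g \<in> radial_functions E k org" for g
    unfolding dual_abel_eq by (rule radial_of_seq)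
  ultimately show "dual_abel E k r org ` even_functions = radial_functions E k org" by blast
qed

lemma dual_abel_inverse:
  assumes g: "dual_abel E k r org g = f" and f: "f \<in> radial_functions E k org"
  defines "fr \<equiv> radial_value E k org f"
  shows "g 0 = fr 0"
    and "g 1 = - ((of_nat k - 2) / (2 * q)) * fr 0 + of_nat r * (of_nat k - 1) / (2 * q) * fr 1"
    and "n \<ge> 2 \<Longrightarrow> g (int n) =
        - ((q ^ 2 - 1 + (of_nat r - of_nat k) * (1 - of_nat k) ^ n) / (2 * of_nat k * q ^ n)) * fr 0
        - of_nat r * (of_nat k - 1) / (2 * of_nat k)
            * (\<Sum>j | 0 < j \<and> j < n - 1.
                 (q ^ 2 - 1 + (of_nat r - of_nat k) * (1 - of_nat k) ^ (n - j))
                   * (q ^ (2 * j) / (q ^ n * q ^ 2)) * fr j)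
        - of_nat r * (of_nat k - 1) * (of_nat k - 2) / 2 * (q ^ n / q ^ 4) * fr (n - 1)
        + of_nat r * (of_nat k - 1) / 2 * (q ^ n / q ^ 2) * fr n"
proof -
  define w where "w n = fr n * of_nat (card (S n))" for n
  have w: "dual_seq g n = w n" for n
    using g dual_abel_eq_iff[OF f] by (auto simp: w_def fr_def)
  have w0: "w 0 = fr 0" by (simp add: w_def sphere_0)
  have w_pos: "w n = of_nat r * (of_nat k - 1) * q ^ (2 * (n - 1)) * fr n" if "n > 0" for n
    using that unfolding w_def card_sphere by simp
  show "g 0 = fr 0" using w[of 0] w0 by (simp add: dual_seq_0)
  have "2 * g 1 * q = of_nat r * (of_nat k - 1) * fr 1 - (of_nat k - 2) * fr 0"
    using dual_seq_inverse[of g w 1, OF w] w_pos[of 1] w0 by simp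
  then have "g 1 = (of_nat r * (of_nat k - 1) * fr 1 - (of_nat k - 2) * fr 0) / (2 * q)"
    using q_nz by (subst eq_divide_eq) (simp add: mult_ac)
  moreover have "(a * u - b * v) / c = - (b / c) * v + a / c * u" for a b c u v :: complex
    by (simp add: diff_divide_distrib)
  ultimately show "g 1 = - ((of_nat k - 2) / (2 * q)) * fr 0 + of_nat r * (of_nat k - 1) / (2 * q) * fr 1"
    by metis
  assume n: "n \<ge> 2"
  define c :: "nat \<Rightarrow> complex" where
    "c i = q ^ 2 - 1 + (of_nat r - of_nat k) * (1 - of_nat k) ^ i" for i
  define A where "A = complex_of_nat r * (of_nat k - 1)"
  have pow: "q ^ (2 * (j - 1)) / q ^ n = q ^ (2 * j) / (q ^ n * q ^ 2)" if "j > 0" for j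
  proof -
    have "2 * j = 2 * (j - 1) + 2" using that by simp
    then have "q ^ (2 * j) = q ^ (2 * (j - 1)) * q ^ 2" by (metis power_add)
    then show ?thesis using q_nz by simp
  qed
  \<comment> \<open>The index 0 is split off because the sphere of radius 0 has one element and does
    not follow the formula r(k-1)Q^(j-1).\<close>
  have "{..<n - 1} = insert 0 {j. 0 < j \<and> j < n - 1}" using n by auto
  then have split: "(\<Sum>j<n - 1. c (n - j) / of_nat k * w j) =
      c n / of_nat k * fr 0 + (\<Sum>j | 0 < j \<and> j < n - 1. c (n - j) / of_nat k * w j)"
    using w0 by simp
  have middle: "(\<Sum>j | 0 < j \<and> j < n - 1. c (n - j) / of_nat k * w j) / q ^ n =
      A / of_nat k * (\<Sum>j | 0 < j \<and> j < n - 1. c (n - j) * (q ^ (2 * j) / (q ^ n * q ^ 2)) * fr j)"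
    unfolding sum_divide_distrib sum_distrib_left
  proof (rule sum.cong[OF refl])
    fix j assume "j \<in> {j. 0 < j \<and> j < n - 1}"
    then have j: "j > 0" by simp
    show "c (n - j) / of_nat k * w j / q ^ n =
        A / of_nat k * (c (n - j) * (q ^ (2 * j) / (q ^ n * q ^ 2)) * fr j)"
      unfolding pow[OF j, symmetric] w_pos[OF j] A_def by simp
  qed
  have top: "w n / q ^ n = A * (q ^ n / q ^ 2) * fr n"
  proof -
    have "q ^ (2 * (n - 1)) / q ^ n = q ^ n / q ^ 2"
      using pow[of n] n q_nz by (simp add: mult_2 power_add)
    moreover have "w n / q ^ n = A * (q ^ (2 * (n - 1)) / q ^ n) * fr n"
      using w_pos[of n] n by (simp add: A_def)
    ultimately show ?thesis by (simp only:)
  qed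
  have next_to_top: "w (n - 1) / q ^ n = A * (q ^ n / q ^ 4) * fr (n - 1)"
  proof -
    have "n + n = 2 * (n - 1 - 1) + 4" using n by simp
    then have "q ^ n * q ^ n = q ^ (2 * (n - 1 - 1)) * q ^ 4" by (metis power_add)
    then have "q ^ (2 * (n - 1 - 1)) / q ^ n = q ^ n / q ^ 4"
      using q_nz by (subst frac_eq_eq) simp_all
    moreover have "w (n - 1) / q ^ n = A * (q ^ (2 * (n - 1 - 1)) / q ^ n) * fr (n - 1)"
      using w_pos[of "n - 1"] n by (simp add: A_def)
    ultimately show ?thesis by (simp only:)
  qed
  have "2 * g (int n) * q ^ n = w n - (of_nat k - 2) * w (n - 1) - (\<Sum>j<n - 1. c (n - j) / of_nat k * w j)"
    using dual_seq_inverse[of g w n, OF w] n by (simp add: c_def)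
  moreover have "x = (u / p - b * (v / p) - s / p) / 2" if "2 * x * p = u - b * v - s" "p \<noteq> 0"
    for x u b v s p :: complex
    using that(2) by (simp add: diff_divide_distrib[symmetric] that(1)[symmetric])
  ultimately have "g (int n) = (w n / q ^ n - (of_nat k - 2) * (w (n - 1) / q ^ n)
      - (\<Sum>j<n - 1. c (n - j) / of_nat k * w j) / q ^ n) / 2"
    using q_nz power_not_zero by metis
  then have "g (int n) = - (c n / (2 * of_nat k * q ^ n)) * fr 0
      - A / (2 * of_nat k) * (\<Sum>j | 0 < j \<and> j < n - 1. c (n - j) * (q ^ (2 * j) / (q ^ n * q ^ 2)) * fr j)
      - A * (of_nat k - 2) / 2 * (q ^ n / q ^ 4) * fr (n - 1) + A / 2 * (q ^ n / q ^ 2) * fr n"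
    unfolding split top next_to_top add_divide_distrib middle
    by (simp add: add_divide_distrib diff_divide_distrib[of _ _ 2] mult_ac)
  then show "g (int n) =
        - ((q ^ 2 - 1 + (of_nat r - of_nat k) * (1 - of_nat k) ^ n) / (2 * of_nat k * q ^ n)) * fr 0
        - of_nat r * (of_nat k - 1) / (2 * of_nat k)
            * (\<Sum>j | 0 < j \<and> j < n - 1.
                 (q ^ 2 - 1 + (of_nat r - of_nat k) * (1 - of_nat k) ^ (n - j))
                   * (q ^ (2 * j) / (q ^ n * q ^ 2)) * fr j)
        - of_nat r * (of_nat k - 1) * (of_nat k - 2) / 2 * (q ^ n / q ^ 4) * fr (n - 1)
        + of_nat r * (of_nat k - 1) / 2 * (q ^ n / q ^ 2) * fr n"
    unfolding c_def A_def .
qed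

lemma dual_seq_linear:
  "dual_seq (\<lambda>h. g1 h + g2 h) n = dual_seq g1 n + dual_seq g2 n"
  "dual_seq (\<lambda>h. c * g h) n = c * dual_seq g n"
proof -
  have fe: "fold_even (\<lambda>h. g1 h + g2 h) h = fold_even g1 h + fold_even g2 h"
    "fold_even (\<lambda>h. c * g h) h = c * fold_even g h" for h
    by (simp_all add: fold_even_def)
  have ps: "parity_sum (\<lambda>h. g1 h + g2 h) n = parity_sum g1 n + parity_sum g2 n"
    "parity_sum (\<lambda>h. c * g h) n = c * parity_sum g n" for n
    by (simp_all add: sum_fold_even_same_parity[symmetric] fe sum.distrib sum_distrib_left)
  show "dual_seq (\<lambda>h. g1 h + g2 h) n = dual_seq g1 n + dual_seq g2 n"
    "dual_seq (\<lambda>h. c * g h) n = c * dual_seq g n"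
    by (simp_all only: dual_seq_def fe ps ring_distribs mult.left_commute mult.assoc add_ac)
qed

end

section \<open>Half-integral powers as quotients of powers of the square root\<close>

lemma powr_eq_sqrt_powr: "Q > 0 \<Longrightarrow> Q powr x = sqrt Q powr (2 * x)" for Q :: real
  by (simp add: powr_half_sqrt[symmetric] powr_powr)

lemma sqrt_power_quotients:
  fixes Q :: real
  assumes "Q > 0"
  shows "Q powr (- 1 / 2) = 1 / sqrt Q"
    and "Q powr (- real n / 2) = 1 / sqrt Q ^ n"
    and "Q powr (real j - real n / 2 - 1) = sqrt Q ^ (2 * j) / (sqrt Q ^ n * sqrt Q ^ 2)"
    and "Q powr (real n / 2 - 2) = sqrt Q ^ n / sqrt Q ^ 4"
    and "Q powr (real n / 2 - 1) = sqrt Q ^ n / sqrt Q ^ 2"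
proof -
  let ?s = "sqrt Q"
  have s: "?s > 0" using assms by simp
  have p: "?s powr real n = ?s ^ n" for n using s by (rule powr_realpow)
  have m: "?s powr (real a - real b) = ?s ^ a / ?s ^ b" for a b
    by (simp only: powr_diff p)
  have e: "Q powr x = ?s ^ a / ?s ^ b" if "2 * x = real a - real b" for x a b
    unfolding powr_eq_sqrt_powr[OF assms, of x] that by (rule m)
  show "Q powr (- 1 / 2) = 1 / sqrt Q" using e[of "- 1 / 2" 0 1] by simp
  show "Q powr (- real n / 2) = 1 / sqrt Q ^ n" using e[of "- real n / 2" 0 n] by simp
  show "Q powr (real j - real n / 2 - 1) = sqrt Q ^ (2 * j) / (sqrt Q ^ n * sqrt Q ^ 2)"
    using e[of "real j - real n / 2 - 1" "2 * j" "n + 2"] by (simp only: power_add) (simp add: algebra_simps)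
  show "Q powr (real n / 2 - 2) = sqrt Q ^ n / sqrt Q ^ 4" using e[of "real n / 2 - 2" n 4] by simp
  show "Q powr (real n / 2 - 1) = sqrt Q ^ n / sqrt Q ^ 2" using e[of "real n / 2 - 1" n 2] by simp
qed

theorem theorem3p8:
  fixes E :: "'v set set" and k r :: nat and org :: 'v and Q \<sigma> :: real
  assumes "k \<ge> 2" and "r \<ge> 2"
    and "symmetric_graph E k r"
    and "Q = (real r - 1) * (real k - 1)"
    and "\<sigma> = real k - 2"
  shows
    "bij_betw (dual_abel E k r org) even_functions (radial_functions E k org) \<and>
     (\<forall>g1\<in>even_functions. \<forall>g2\<in>even_functions.
        dual_abel E k r org (\<lambda>h. g1 h + g2 h) =
          (\<lambda>x. dual_abel E k r org g1 x + dual_abel E k r org g2 x)) \<and>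
     (\<forall>c. \<forall>g\<in>even_functions.
        dual_abel E k r org (\<lambda>h. c * g h) = (\<lambda>x. c * dual_abel E k r org g x)) \<and>
     (\<forall>f\<in>radial_functions E k org.
        let g = the_inv_into even_functions (dual_abel E k r org) f;
            fr = radial_value E k org f
        in
          g 0 = fr 0 \<and>
          g 1 = of_real (- (\<sigma> / 2) * Q powr (- 1 / 2)) * fr 0
              + of_real (real r * (real k - 1) / 2 * Q powr (- 1 / 2)) * fr 1 \<and>
          (\<forall>n::nat. n \<ge> 2 \<longrightarrow>
             g (int n) =
               - of_real (1 / (2 * real k) * (Q - 1 + (real r - real k) * (1 - real k) ^ n)
                     * Q powr (- real n / 2)) * fr 0
               - of_real (real r * (real k - 1) / (2 * real k))
                   * (\<Sum>j | 0 < j \<and> j < n - 1.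
                        of_real ((Q - 1 + (real r - real k) * (1 - real k) ^ (n - j))
                          * Q powr (real j - real n / 2 - 1)) * fr j)
               - of_real (1 / 2 * real r * (real k - 1) * \<sigma> * Q powr (real n / 2 - 2)) * fr (n - 1)
               + of_real (1 / 2 * real r * (real k - 1) * Q powr (real n / 2 - 1)) * fr n))"
proof -
  interpret rooted_symmetric_graph E k r org
    using assms(1-3) by (simp add: rooted_symmetric_graph_def rooted_symmetric_graph_axioms_def)
  have Q: "Q = branching k r" "Q > 0" using assms(4) branching_pos by (simp_all add: branching_def)
  have q2: "complex_of_real (sqrt Q) ^ 2 = of_real Q" using Q(2) by (simp flip: of_real_power)
  have inverse: "dual_abel E k r org (the_inv_into even_functions (dual_abel E k r org) f) = f"
    if "f \<in> radial_functions E k org" for f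
    using f_the_inv_into_f_bij_betw[OF bij_betw_dual_abel] that by blast
  note powr = sqrt_power_quotients[OF Q(2)]
  show ?thesis
  proof (intro conjI ballI allI, goal_cases)
    case 1
    show ?case by (rule bij_betw_dual_abel)
  next
    case (2 g1 g2)
    show ?case by (simp add: dual_abel_eq dual_seq_linear add_divide_distrib)
  next
    case (3 c g)
    show ?case by (simp add: dual_abel_eq dual_seq_linear)
  next
    case (4 f)
    note inv = dual_abel_inverse[OF inverse[OF 4] 4, folded Q(1), unfolded q2]
    show ?case
      unfolding Let_def powr assms(5)
    proof (intro conjI allI impI, goal_cases)
      case 1
      show ?case by (rule inv)
    next
      case 2
      show ?case using inv(2) by simp
    next
      case (3 n)
      show ?case using inv(3)[OF 3] by (simp add: mult.assoc q2)
    qed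
  qed
qed

end
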